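(* Let $P\subseteq\mathbb{R}^d$ be a convex $d$-dimensional lattice polytope (all vertices in $\mathbb{Z}^d$). For an integer $k\ge 1$ let $b(kP)=|\partial(kP)\cap\mathbb{Z}^d|$ be the number of lattice points on the boundary of the dilate $kP=\{kx: x\in P\}$, and let $$\mathrm{surf}(P)=\sum_{F \text{ facet of } P}\frac{\mathrm{vol}_{d-1}(F)}{\det(\mathrm{aff}\,F\cap\mathbb{Z}^d)}$$ be the lattice surface area of $P$. (a) Suppose $d$ is odd and put $t=\frac{d-1}{2}$. Let $\mathbf{D}$ be the $t\times t$ matrix with entries $\mathbf{D}_{k,j}=k^{d+1-2j}$ ($1\le k,j\le t$), i.e. row $k$ is $(k^{d-1},k^{d-3},\dots,k^{2})$, and let $\mathbf{A}$ be the matrix obtained from $\mathbf{D}$ by replacing its first column by the column $(b(kP)-2)_{k=1,\dots,t}$, i.e. row $k$ of $\mathbf{A}$ is $(b(kP)-2,\,k^{d-3},\dots,k^{2})$. Then $$\mathrm{surf}(P)=\frac{\det\mathbf{A}}{\det\mathbf{D}}.$$ (b) Suppose $d$ is even and put $t=\frac{d}{2}$. Let $\mathbf{D}$ be the $t\times t$ matrix with entries $\mathbf{D}_{k,j}=k^{d+1-2j}$ ($1\le k,j\le t$), i.e. row $k$ is $(k^{d-1},k^{d-3},\dots,k)$, and let $\mathbf{B}$ be the matrix obtained from $\mathbf{D}$ by replacing its first column by $(b(kP))_{k=1,\dots,t}$, i.e. row $k$ of $\mathbf{B}$ is $(b(kP),\,k^{d-3},\dots,k)$. Then $$\mathrm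{surf}(P)=\frac{\det\mathbf{B}}{\det\mathbf{D}}.$$
   Context: $\mathrm{vol}_{d-1}(F)$ denotes the $(d-1)$-dimensional Euclidean volume of the facet $F$, and $\det(\mathrm{aff}\,F\cap\mathbb{Z}^d)$ denotes the determinant of the $(d-1)$-dimensional sublattice of $\mathbb{Z}^d$ contained in the affine hull of $F$. $\partial(kP)$ denotes the boundary of $kP$.
   Formalization: Part (a) is stated for odd d ≥ 3: for d = 1 we have t = 0, so D has no first column to replace, and with empty determinants the quotient would be 1 although surf(P) = 2. *)

theory Defs
  imports "HOL-Analysis.Analysis" "Jordan_Normal_Form.Determinant"
begin

hide_const (open) Finite_Cartesian_Product.vec Determinants.det Matrix.orthogonal

(* The library's lborel is the image of the product measure over Basis under coordinate
   expansion.  The same construction, with an orthonormal system B and an origin a, gives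
   Lebesgue measure (of dimension card B) on the flat a + span B. *)
definition flat_lborel :: "'a::euclidean_space \<Rightarrow> 'a set \<Rightarrow> 'a measure" where
  "flat_lborel a B = distr (Pi\<^sub>M B (\<lambda>_. lborel)) borel (\<lambda>f. a + (\<Sum>b\<in>B. f b *\<^sub>R b))"

definition orthonormal_basis_of :: "'a::euclidean_space set \<Rightarrow> 'a set \<Rightarrow> bool" where
  "orthonormal_basis_of B V \<longleftrightarrow> pairwise orthogonal B \<and> (\<forall>b\<in>B. norm b = 1) \<and> span B = V"

(* The m-dimensional Euclidean volume of a nonempty Borel set S with m = aff_dim S: Lebesgue
   measure on the affine hull of S with respect to Cartesian coordinates there.  The value
   depends neither on the chosen origin nor on the chosen orthonormal basis. *)
definition rel_volume :: "'a::euclidean_space set \<Rightarrow> real" where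
  "rel_volume S =
    (let a = (SOME a. a \<in> S);
         B = (SOME B. orthonormal_basis_of B (span {x - y | x y. x \<in> S \<and> y \<in> S}))
     in measure (flat_lborel a B) S)"

definition int_points :: "(real ^ 'n) set" where
  "int_points = {x. \<forall>i. vec_nth x i \<in> \<int>}"

definition lattice_basis :: "'a::euclidean_space set \<Rightarrow> 'a set \<Rightarrow> bool" where
  "lattice_basis B L \<longleftrightarrow>
    independent B \<and> L = range (\<lambda>c::'a \<Rightarrow> int. \<Sum>b\<in>B. of_int (c b) *\<^sub>R b)"

definition fund_parallelepiped :: "'a::euclidean_space set \<Rightarrow> 'a set" where
  "fund_parallelepiped B = {\<Sum>b\<in>B. c b *\<^sub>R b | c. \<forall>b\<in>B. 0 \<le> c b \<and> c b < 1}"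

(* For a lattice L of any rank, relative to its own linear span; independent of the basis. *)
definition lattice_det :: "'a::euclidean_space set \<Rightarrow> real" where
  "lattice_det L = rel_volume (fund_parallelepiped (SOME B. lattice_basis B L))"

(* The integer points of a flat H form a translate of a lattice; this is that lattice,
   and the determinant of the affine lattice is by definition its determinant. *)
definition flat_lattice :: "(real ^ 'n) set \<Rightarrow> (real ^ 'n) set" where
  "flat_lattice H = {x - y | x y. x \<in> H \<inter> int_points \<and> y \<in> H \<inter> int_points}"

definition lattice_polytope :: "(real ^ 'n) set \<Rightarrow> bool" where
  "lattice_polytope P \<longleftrightarrow> polytope P \<and> {v. v extreme_point_of P} \<subseteq> int_points"

definition dilate :: "nat \<Rightarrow> (real ^ 'n) set \<Rightarrow> (real ^ 'n) set" where
  "dilate k P = (\<lambda>x. real k *\<^sub>R x) ` P"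

definition boundary_count :: "(real ^ 'n) set \<Rightarrow> nat" where
  "boundary_count P = card (frontier P \<inter> int_points)"

definition lattice_surface :: "(real ^ 'n) set \<Rightarrow> real" where
  "lattice_surface P =
    (\<Sum>F\<in>{F. F facet_of P}. rel_volume F / lattice_det (flat_lattice (affine hull F)))"

(* Rows and columns are numbered from 0 in type mat, hence the successors. *)
definition dilation_matrix :: "nat \<Rightarrow> nat \<Rightarrow> real mat" where
  "dilation_matrix d t = mat t t (\<lambda>(i, j). real (Suc i) ^ (d + 1 - 2 * Suc j))"

end

(* The boundary count b(kP) is the number of lattice points of kP minus the number of those in its
   interior. Cutting P into lattice simplices, and half-opening each of them as seen from a generic
   interior point, shows that the first number is f(k) for a polynomial f of degree at most d with
   f(0) = 1. Looking away from that point instead yields the interior and removes the complementary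
   facets, and replacing fractional parts r by 1 - r gives the second number as (-1)^d f(-k). So
   b(kP) = f(k) - (-1)^d f(-k) is a polynomial in k containing only the powers k^(d-1), k^(d-3), ...,
   and with constant term 2 or 0. Its leading coefficient is the limit of b(kP) / k^(d-1), which is
   the lattice surface area, because the lattice points of kF can be counted by tiling the flat of a
   facet F with fundamental parallelepipeds. Cramer's rule recovers that coefficient. *)
theory Submission
  imports Defs
begin

text \<open>Half-opening avoids any description of how the simplices of a triangulation meet. A
  point is assigned to the cell that contains it after a slight move along the line through a
  generic interior point \<open>q\<close>, so uniqueness of the cell is required only off finitely
  many flats of smaller dimension. Genericity means that \<open>q\<close> lies on none of these
  flats and on no hyperplane of a facet of a cell. Then all barycentric coordinates of
  \<open>q\<close> are nonzero, and this is what makes the facets removed by the two directions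
  complementary. The value f(0) = 1 reflects that exactly one cell, the one containing
  \<open>q\<close>, loses no facet.

  The obstacle in the leading coefficient is that facets overlap. Instead of estimating the
  overlaps, the boundary count is squeezed between the counts for relative interiors, which are
  disjoint, and those for closed facets. Tiling therefore has to yield the same limit for a convex
  body and for its relative interior.\<close>

section \<open>Triangulating a polytope without new vertices\<close>

text \<open>The simplices are obtained by pulling a vertex \<open>v\<close>: they join \<open>v\<close> to the simplices of the facets
avoiding \<open>v\<close>. The family \<open>\<H>\<close> collects the flats of smaller dimension on which cells may overlap,
so that nothing has to be said about how the simplices meet.\<close>

lemma polytope_triangulation:
  fixes Q :: "'a::euclidean_space set"
  assumes "polytope Q" "Q \<noteq> {}"
  shows "\<exists>\<W> \<H>. finite \<W> \<and> finite \<H> \<and>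
     (\<forall>W\<in>\<W>. W \<subseteq> {v. v extreme_point_of Q} \<and> \<not> affine_dependent W \<and> aff_dim W = aff_dim Q) \<and>
     (\<forall>H\<in>\<H>. affine H \<and> aff_dim H < aff_dim Q) \<and>
     (\<forall>x\<in>Q - \<Union>\<H>. \<exists>!W. W \<in> \<W> \<and> x \<in> convex hull W)"
  using assms
proof (induction "nat (aff_dim Q)" arbitrary: Q rule: less_induct)
  case less
  note Q = \<open>polytope Q\<close> \<open>Q \<noteq> {}\<close>
  have cv: "convex Q" and cp: "compact Q" and bd: "bounded Q" and ph: "polyhedron Q"
    using Q polytope_imp_convex polytope_imp_compact polytope_imp_bounded polytope_imp_polyhedron
    by auto
  obtain v where v: "v extreme_point_of Q"
    using extreme_point_exists_convex[OF cp cv Q(2)] by auto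
  then have vQ: "v \<in> Q" by (simp add: extreme_point_of_def)
  have nonneg: "aff_dim Q \<ge> 0" using Q(2) by (meson aff_dim_negative_iff not_le)
  define \<F> where "\<F> = {F. F facet_of Q \<and> v \<notin> F}"
  have finF: "finite {F. F facet_of Q}"
    using finite_polytope_facets Q(1) by auto
  have finfF: "finite \<F>" unfolding \<F>_def using finF by (auto intro: finite_subset[rotated])
  have face: "F face_of Q" "F \<noteq> {}" "aff_dim F = aff_dim Q - 1" if "F facet_of Q" for F
    using that unfolding facet_of_def by auto
  define tri where "tri F \<W> \<H> \<longleftrightarrow> finite \<W> \<and> finite \<H> \<and>
     (\<forall>W\<in>\<W>. W \<subseteq> {v. v extreme_point_of F} \<and> \<not> affine_dependent W \<and> aff_dim W = aff_dim F) \<and>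
     (\<forall>H\<in>\<H>. affine H \<and> aff_dim H < aff_dim F) \<and>
     (\<forall>x\<in>F - \<Union>\<H>. \<exists>!W. W \<in> \<W> \<and> x \<in> convex hull W)" for F :: "'a set" and \<W> \<H>
  have ex: "\<exists>\<W> \<H>. tri F \<W> \<H>" if "F \<in> \<F>" for F
    unfolding tri_def
  proof (rule less.hyps)
    have "F facet_of Q" using that by (simp add: \<F>_def)
    note fF = face[OF this]
    show "F \<noteq> {}" "polytope F" using fF Q face_of_polytope_polytope by auto
    show "nat (aff_dim F) < nat (aff_dim Q)"
      using fF aff_dim_negative_iff[of F] by auto
  qed
  then obtain \<W> \<H> where tri: "\<And>F. F \<in> \<F> \<Longrightarrow> tri F (\<W> F) (\<H> F)" by metis
  have finWH: "finite (\<W> F)" "finite (\<H> F)"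
    and H: "\<And>H. H \<in> \<H> F \<Longrightarrow> affine H" "\<And>H. H \<in> \<H> F \<Longrightarrow> aff_dim H < aff_dim F"
    and U: "\<And>x. x \<in> F \<Longrightarrow> x \<notin> \<Union>(\<H> F) \<Longrightarrow> \<exists>!W. W \<in> \<W> F \<and> x \<in> convex hull W"
    if "F \<in> \<F>" for F
    using tri[OF that] unfolding tri_def by blast+
  have W: "W \<subseteq> {v. v extreme_point_of F}" "\<not> affine_dependent W" "aff_dim W = aff_dim F"
    if "F \<in> \<F>" "W \<in> \<W> F" for F W
    using tri[OF that(1)] that(2) unfolding tri_def by blast+
  show ?case
  proof (cases "aff_dim Q = 0")
    \<comment> \<open>A point has no facet, because facets are nonempty by definition, so pulling
      would produce no cell here.\<close>
    case True
    then obtain a where a: "Q = {a}" using aff_dim_eq_0 by blast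
    show ?thesis
      unfolding a
    proof (rule exI[of _ "{{a}}"], rule exI[of _ "{}"], intro conjI ballI)
      show "\<exists>!W. W \<in> {{a}} \<and> x \<in> convex hull W" if "x \<in> {a} - \<Union>{}" for x
        using that by (intro ex1I[of _ "{a}"]) simp_all
    qed simp_all
  next
    case False
    then have pos: "aff_dim Q \<ge> 1" using nonneg by simp
    define \<W>' where "\<W>' = (\<Union>F\<in>\<F>. insert v ` \<W> F)"
    \<comment> \<open>Outside these flats the projection from \<open>v\<close> behaves generically:
      \<open>\<H>1\<close> cones off the exceptional flats of the facets, \<open>\<H>2\<close>
      contains the points that project into two chosen facets, and avoiding \<open>\<H>3\<close>
      forces \<open>x\<close> into the relative interior. The point \<open>v\<close> itself has no
      projection.\<close>
    define \<H>1 where "\<H>1 = (\<Union>F\<in>\<F>. (\<lambda>H. affine hull (insert v H)) ` \<H> F)"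
    define \<H>2 where "\<H>2 = (\<lambda>(F,F'). affine hull (insert v (F \<inter> F'))) ` {(F,F') \<in> \<F>\<times>\<F>. F \<noteq> F'}"
    define \<H>3 where "\<H>3 = (\<lambda>F. affine hull F) ` {F. F facet_of Q}"
    define \<H>' where "\<H>' = insert {v} (\<H>1 \<union> \<H>2 \<union> \<H>3)"
    have finW': "finite \<W>'" using finfF finWH by (auto simp: \<W>'_def)
    have "finite \<H>2" unfolding \<H>2_def
      by (rule finite_imageI, rule finite_subset[of _ "\<F>\<times>\<F>"]) (use finfF in auto)
    then have finH': "finite \<H>'" using finfF finF finWH by (auto simp: \<H>'_def \<H>1_def \<H>3_def)
    have H': "affine H \<and> aff_dim H < aff_dim Q" if HH: "H \<in> \<H>'" for H
    proof -
      consider "H = {v}" | "H \<in> \<H>1" | "H \<in> \<H>2" | "H \<in> \<H>3" using HH by (auto simp: \<H>'_def)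
      then show ?thesis
      proof cases
        case 1 then show ?thesis using pos by simp
      next
        case 2
        then obtain F H0 where F: "F \<in> \<F>" "H0 \<in> \<H> F" "H = affine hull (insert v H0)"
          by (auto simp: \<H>1_def)
        have "aff_dim F = aff_dim Q - 1" using F face by (auto simp: \<F>_def)
        then show ?thesis using F H(2)[OF F(1,2)] by (simp add: aff_dim_insert)
      next
        case 3
        then obtain F F' where F: "F \<in> \<F>" "F' \<in> \<F>" "F \<noteq> F'" "H = affine hull (insert v (F \<inter> F'))"
          by (auto simp: \<H>2_def)
        have ff: "F face_of Q" "F' face_of Q" "aff_dim F = aff_dim Q - 1" "aff_dim F' = aff_dim Q - 1"
          using F face by (auto simp: \<F>_def)
        have cF: "convex F" "convex F'" using ff face_of_imp_convex by auto
        have "F \<inter> F' face_of F" "F \<inter> F' face_of F'"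
          using ff by (meson face_of_Int face_of_subset face_of_imp_subset inf_le1 inf_le2)+
        moreover have "F \<inter> F' \<noteq> F \<or> F \<inter> F' \<noteq> F'" using F by auto
        ultimately have "aff_dim (F \<inter> F') < aff_dim Q - 1"
          using face_of_aff_dim_lt cF ff by metis
        then show ?thesis using F by (simp add: aff_dim_insert)
      next
        case 4 then show ?thesis using face by (auto simp: \<H>3_def)
      qed
    qed
    have W': "W \<subseteq> {v. v extreme_point_of Q} \<and> \<not> affine_dependent W \<and> aff_dim W = aff_dim Q"
      if WW: "W \<in> \<W>'" for W
    proof -
      obtain F W0 where F: "F \<in> \<F>" "W0 \<in> \<W> F" "W = insert v W0" using WW by (auto simp: \<W>'_def)
      have ff: "F face_of Q" "aff_dim F = aff_dim Q - 1" "v \<notin> F"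
        using F face by (auto simp: \<F>_def)
      have ext: "W0 \<subseteq> {v. v extreme_point_of F}" using W F by auto
      then have "W0 \<subseteq> F" by (auto simp: extreme_point_of_def)
      have "v \<notin> affine hull F"
        using ff face_of_imp_eq_affine_Int[OF cv ff(1)] vQ by blast
      then have nv: "v \<notin> affine hull W0" using \<open>W0 \<subseteq> F\<close> hull_mono by blast
      have "W0 \<subseteq> {v. v extreme_point_of Q}" using ext ff extreme_point_of_face by blast
      moreover have "\<not> affine_dependent W"
        using W(2)[OF F(1,2)] nv F affine_independent_insert by blast
      moreover have "aff_dim W = aff_dim Q"
        using nv F(3) W(3)[OF F(1,2)] ff by (simp add: aff_dim_insert)
      ultimately show ?thesis using v F(3) by auto
    qed
    have hullW: "convex hull W \<subseteq> F" if "F \<in> \<F>" "W \<in> \<W> F" for F W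
    proof -
      have "W \<subseteq> F" using W(1)[OF that] by (auto simp: extreme_point_of_def)
      moreover have "convex F" using that(1) face(1)[of F] face_of_imp_convex unfolding \<F>_def by blast
      ultimately show ?thesis by (simp add: hull_minimal)
    qed
    have Wne: "W \<noteq> {}" if "F \<in> \<F>" "W \<in> \<W> F" for F W
    proof
      assume "W = {}"
      then have "aff_dim F = -1" using W(3)[OF that] by simp
      moreover have "F facet_of Q" using that(1) by (simp add: \<F>_def)
      then have "aff_dim F = aff_dim Q - 1" by (rule face(3))
      ultimately show False using pos by simp
    qed
    \<comment> \<open>The ray from \<open>v\<close> through \<open>x\<close> leaves \<open>Q\<close>
      at a point \<open>y\<close> of a facet \<open>F\<close> that avoids \<open>v\<close>. The cell
      of \<open>x\<close> is the join of \<open>v\<close> with the cell of \<open>y\<close> in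
      \<open>F\<close>.\<close>
    have uniq: "\<exists>!W. W \<in> \<W>' \<and> x \<in> convex hull W" if x: "x \<in> Q" "x \<notin> \<Union>\<H>'" for x
    proof -
      have xv: "x \<noteq> v" using x by (auto simp: \<H>'_def)
      have nfac: "x \<notin> F" if "F facet_of Q" for F
        using x that hull_subset[of F affine] by (auto simp: \<H>'_def \<H>3_def)
      have rf: "rel_frontier Q = \<Union>{F. F facet_of Q}"
        using rel_frontier_of_polyhedron[OF ph] .
      have xri: "x \<in> rel_interior Q"
        using x(1) nfac rf closure_subset[of Q] unfolding rel_frontier_def by blast
      have "x + (x - v) \<in> affine hull Q"
      proof -
        have "2 *\<^sub>R x + (-1) *\<^sub>R v \<in> affine hull Q"
          using x(1) vQ by (intro mem_affine[OF affine_affine_hull]) (auto simp: hull_inc)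
        then show ?thesis by (simp add: scaleR_2 add_diff_eq)
      qed
      then obtain t where t: "t > 0" "x + t *\<^sub>R (x - v) \<in> rel_frontier Q"
        using ray_to_rel_frontier[OF bd xri, of "x - v"] xv by auto
      define y where "y = x + t *\<^sub>R (x - v)"
      obtain F where F: "F facet_of Q" "y \<in> F" using t rf y_def by auto
      have xy: "x = (1 - 1/(1+t)) *\<^sub>R v + (1/(1+t)) *\<^sub>R y"
      proof -
        define s where "s = 1/(1+t)"
        have st: "s * t = 1 - s" using t(1) by (simp add: s_def field_simps)
        have "s *\<^sub>R y = s *\<^sub>R x + (s * t) *\<^sub>R (x - v)" by (simp add: y_def scaleR_right_distrib)
        then show ?thesis unfolding st s_def[symmetric] by (simp add: algebra_simps)
      qed
      have vF: "v \<notin> F"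
      proof
        assume "v \<in> F"
        moreover have "convex F" using F face face_of_imp_convex by blast
        ultimately have "x \<in> F"
          unfolding xy using F t(1) by (intro convexD) (auto simp: field_simps)
        then show False using nfac F by blast
      qed
      then have FF: "F \<in> \<F>" using F by (simp add: \<F>_def)
      \<comment> \<open>The base point \<open>w\<close> of any join containing \<open>x\<close> lies
        on the same ray as \<open>y\<close>. If the two differed, one would lie strictly between
        \<open>v\<close> and the other, and the face property would put \<open>v\<close> into a
        facet that avoids it. Equality of the facets then follows from \<open>\<H>2\<close>.\<close>
      have key: "F' = F \<and> y \<in> convex hull W" if W': "F' \<in> \<F>" "W \<in> \<W> F'" "x \<in> convex hull (insert v W)" for F' W
      proof -
        obtain u w where uw: "0 \<le> u" "u \<le> 1" "w \<in> convex hull W" "x = (1-u) *\<^sub>R v + u *\<^sub>R w"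
          using W'(3) Wne[OF W'(1,2)] unfolding convex_hull_insert_alt by (auto) 
        have wF: "w \<in> F'" using hullW[OF W'(1,2)] uw by auto
        have f': "F' face_of Q" "v \<notin> F'" using W'(1) face by (auto simp: \<F>_def)
        have wQ: "w \<in> Q" using wF f' face_of_imp_subset by blast
        have yQ: "y \<in> Q" using F face face_of_imp_subset by blast
        have u0: "u \<noteq> 0" using uw xv by auto
        define s where "s = 1/(1+t)"
        have s: "0 < s" "s < 1" using t(1) by (auto simp: s_def)
        have e: "u *\<^sub>R (w - v) = s *\<^sub>R (y - v)"
          using uw(4) xy[folded s_def] by (simp add: algebra_simps)
        have "w = y"
        proof (cases u s rule: linorder_cases)
          case less
          have "y - v = (u/s) *\<^sub>R (w - v)"
            using arg_cong[OF e, of "\<lambda>z. (1/s) *\<^sub>R z"] s by simp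
          then have "y = (1 - u/s) *\<^sub>R v + (u/s) *\<^sub>R w" by (simp add: algebra_simps)
          moreover have "0 < u/s" "u/s < 1" using less u0 uw s by auto
          moreover have "v \<noteq> w" using wF f' by auto
          ultimately have "y \<in> open_segment v w" using in_segment(2) by metis
          then have "v \<in> F" using face_ofD[OF face(1)[OF F(1)] _ vQ wQ F(2)] by blast
          then show ?thesis using vF by simp
        next
          case equal
          then show ?thesis using e s by simp
        next
          case greater
          have "w - v = (s/u) *\<^sub>R (y - v)"
            using arg_cong[OF e, of "\<lambda>z. (1/u) *\<^sub>R z"] u0 by simp
          then have "w = (1 - s/u) *\<^sub>R v + (s/u) *\<^sub>R y" by (simp add: algebra_simps)
          moreover have "0 < s/u" "s/u < 1" using greater u0 uw s by auto
          moreover have "v \<noteq> y" using vF F by auto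
          ultimately have "w \<in> open_segment v y" using in_segment(2) by metis
          then have "v \<in> F'" using face_ofD[OF f'(1) _ vQ yQ wF] by blast
          then show ?thesis using f' by simp
        qed
        moreover have "F' = F"
        proof (rule ccontr)
          assume "F' \<noteq> F"
          then have "affine hull (insert v (F \<inter> F')) \<in> \<H>'"
            using FF W'(1) by (auto simp: \<H>'_def \<H>2_def)
          moreover have "x \<in> affine hull (insert v (F \<inter> F'))"
            unfolding xy using \<open>w = y\<close> wF F(2)
            by (intro mem_affine[OF affine_affine_hull]) (auto simp: hull_inc)
          ultimately show False using x by blast
        qed
        ultimately show ?thesis using uw by simp
      qed
      have "y \<notin> \<Union>(\<H> F)"
      proof
        assume "y \<in> \<Union>(\<H> F)"
        then obtain H where H: "H \<in> \<H> F" "y \<in> H" by auto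
        then have "affine hull (insert v H) \<in> \<H>'" using FF by (auto simp: \<H>'_def \<H>1_def)
        moreover have "x \<in> affine hull (insert v H)"
          unfolding xy using H by (intro mem_affine[OF affine_affine_hull]) (auto simp: hull_inc)
        ultimately show False using x by blast
      qed
      then obtain W0 where W0: "W0 \<in> \<W> F" "y \<in> convex hull W0"
        and un: "\<And>W. W \<in> \<W> F \<Longrightarrow> y \<in> convex hull W \<Longrightarrow> W = W0"
        using U[OF FF F(2)] by blast
      show ?thesis
      proof (rule ex1I[of _ "insert v W0"])
        have "x \<in> convex hull (insert v W0)"
        proof -
          have "y \<in> convex hull (insert v W0)" using W0(2) hull_mono[of W0 "insert v W0"] by blast
          then show ?thesis
            unfolding xy using t(1)
            by (intro convexD[OF convex_convex_hull]) (auto simp: hull_inc field_simps)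
        qed
        then show "insert v W0 \<in> \<W>' \<and> x \<in> convex hull insert v W0"
          using FF W0 by (auto simp: \<W>'_def)
        show "W = insert v W0" if WW: "W \<in> \<W>' \<and> x \<in> convex hull W" for W
        proof -
          obtain F' W1 where "F' \<in> \<F>" "W1 \<in> \<W> F'" "W = insert v W1"
            using WW by (auto simp: \<W>'_def)
          then show ?thesis using key[of F' W1] WW un by auto
        qed
      qed
    qed
    show ?thesis
    proof (rule exI[of _ \<W>'], rule exI[of _ \<H>'], intro conjI ballI)
      show "\<exists>!W. W \<in> \<W>' \<and> x \<in> convex hull W" if "x \<in> Q - \<Union>\<H>'" for x
        using that uniq by simp
    qed (use finW' finH' W' H' in blast)+
  qed
qed

section \<open>Lattice points in half-open simplices\<close>

text \<open>Stars and bars. One element \<open>w\<close> is split off; the sum \<open>j\<close> of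
  the remaining values runs from 0 to \<open>N\<close>, and the hockey-stick identity
  \<open>sum_choose_lower\<close> closes the induction.\<close>

lemma card_compositions:
  assumes "finite W" "card W = Suc m"
  shows "finite {n \<in> W \<rightarrow>\<^sub>E (UNIV :: nat set). sum n W = N} \<and>
         card {n \<in> W \<rightarrow>\<^sub>E (UNIV :: nat set). sum n W = N} = (N + m) choose m"
  using assms
proof (induction m arbitrary: W N)
  case 0
  then obtain w where w: "W = {w}" by (metis One_nat_def card_1_singletonE)
  have "{n \<in> W \<rightarrow>\<^sub>E (UNIV :: nat set). sum n W = N} = {\<lambda>x\<in>W. N}"
    unfolding w by (auto simp: PiE_def extensional_def fun_eq_iff)
  then show ?case by simp
next
  case (Suc m)
  then obtain w where w: "w \<in> W" by fastforce
  define V where "V = W - {w}"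
  have V: "finite V" "card V = Suc m" "w \<notin> V" "W = insert w V"
    using Suc w by (auto simp: V_def)
  let ?C = "\<lambda>V N. {n \<in> V \<rightarrow>\<^sub>E (UNIV :: nat set). sum n V = N}"
  note IH = Suc.IH[OF V(1,2)]
  \<comment> \<open>Resetting \<open>w\<close> to \<open>undefined\<close> is what makes the
    restricted function extensional on \<open>V\<close>.\<close>
  have bij: "bij_betw (\<lambda>(j, n). n(w := N - j)) (Sigma {..N} (?C V)) (?C W N)"
  proof (rule bij_betwI[where g = "\<lambda>n. (N - n w, n(w := undefined))"])
    show "(\<lambda>(j, n). n(w := N - j)) \<in> Sigma {..N} (?C V) \<rightarrow> ?C W N"
    proof
      fix p assume "p \<in> Sigma {..N} (?C V)"
      then obtain j n where p: "p = (j, n)" "j \<le> N" "n \<in> V \<rightarrow>\<^sub>E UNIV" "sum n V = j" by auto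
      have "n(w := N - j) \<in> W \<rightarrow>\<^sub>E UNIV" using p V by (auto simp: PiE_def extensional_def)
      moreover have "sum (n(w := N - j)) V = sum n V" using V by (intro sum.cong) auto
      then have "sum (n(w := N - j)) W = N" using V p by simp
      ultimately show "(case p of (j, n) \<Rightarrow> n(w := N - j)) \<in> ?C W N" using p by simp
    qed
    show "(\<lambda>n. (N - n w, n(w := undefined))) \<in> ?C W N \<rightarrow> Sigma {..N} (?C V)"
    proof
      fix n assume n: "n \<in> ?C W N"
      have "sum (n(w := undefined)) V = sum n V" using V by (intro sum.cong) auto
      then show "(N - n w, n(w := undefined)) \<in> Sigma {..N} (?C V)"
        using n V by (auto simp: PiE_def extensional_def)
    qed
    show "(\<lambda>n. (N - n w, n(w := undefined))) ((\<lambda>(j, n). n(w := N - j)) p) = p"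
      if "p \<in> Sigma {..N} (?C V)" for p
      using that V by (auto simp: PiE_def extensional_def fun_eq_iff)
    show "(\<lambda>(j, n). n(w := N - j)) ((\<lambda>n. (N - n w, n(w := undefined))) n) = n"
      if "n \<in> ?C W N" for n
      using that V by (auto simp: PiE_def extensional_def fun_eq_iff)
  qed
  then have b: "finite (?C W N) = finite (Sigma {..N} (?C V))" "card (?C W N) = card (Sigma {..N} (?C V))"
    using bij_betw_finite[OF bij] bij_betw_same_card[OF bij] by simp_all
  have "card (Sigma {..N} (?C V)) = (\<Sum>j\<le>N. (m + j) choose m)"
    using IH by (subst card_SigmaI) (auto simp: add.commute)
  also have "\<dots> = (\<Sum>j\<le>N. (m + j) choose j)"
    by (intro sum.cong refl) (metis add_diff_cancel_left' binomial_symmetric le_add1)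
  also have "\<dots> = Suc (m + N) choose N" by (rule sum_choose_lower)
  also have "\<dots> = (N + Suc m) choose Suc m"
    by (metis add.commute add_Suc_right add_diff_cancel_right' binomial_symmetric le_add2)
  finally show ?case using b IH by auto
qed

section \<open>Integer points in bounded sets\<close>

lemma int_points_add: "x \<in> int_points \<Longrightarrow> y \<in> int_points \<Longrightarrow> x + y \<in> int_points"
  by (auto simp: int_points_def)

lemma int_points_diff: "x \<in> int_points \<Longrightarrow> y \<in> int_points \<Longrightarrow> x - y \<in> int_points"
  by (auto simp: int_points_def)

lemma int_points_scale: "x \<in> int_points \<Longrightarrow> c \<in> \<int> \<Longrightarrow> c *\<^sub>R x \<in> int_points"
  by (auto simp: int_points_def)

lemma int_points_sum: "(\<And>i. i \<in> A \<Longrightarrow> f i \<in> int_points) \<Longrightarrow> (\<Sum>i\<in>A. f i) \<in> int_points"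
  by (auto simp: int_points_def intro!: Ints_sum)

lemma finite_int_points_bounded:
  fixes S :: "(real^'n) set"
  assumes "bounded S"
  shows "finite (S \<inter> int_points)"
proof -
  obtain B where B: "\<And>x. x \<in> S \<Longrightarrow> norm x \<le> B" using assms bounded_iff by blast
  define f where "f x = (\<lambda>i. \<lfloor>vec_nth x i\<rfloor>)" for x :: "real^'n"
  have "finite (UNIV \<rightarrow>\<^sub>E {-\<lceil>B\<rceil>..\<lceil>B\<rceil>} :: ('n \<Rightarrow> int) set)"
    by (rule finite_PiE) auto
  moreover have "f ` (S \<inter> int_points) \<subseteq> (UNIV \<rightarrow>\<^sub>E {-\<lceil>B\<rceil>..\<lceil>B\<rceil>})"
  proof safe
    fix x i assume x: "x \<in> S"
    have "\<bar>vec_nth x i\<bar> \<le> B" using component_le_norm_cart[of x i] B[OF x] by linarith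
    then show "f x i \<in> {-\<lceil>B\<rceil>..\<lceil>B\<rceil>}" unfolding f_def by (simp add: abs_le_iff) linarith
  qed auto
  moreover have "inj_on f (S \<inter> int_points)"
  proof (rule inj_onI)
    fix x y assume *: "x \<in> S \<inter> int_points" "y \<in> S \<inter> int_points" "f x = f y"
    have "vec_nth x i = vec_nth y i" for i
    proof -
      have "of_int \<lfloor>vec_nth x i\<rfloor> = vec_nth x i" "of_int \<lfloor>vec_nth y i\<rfloor> = vec_nth y i"
        using * by (auto simp: int_points_def)
      moreover have "\<lfloor>vec_nth x i\<rfloor> = \<lfloor>vec_nth y i\<rfloor>" using * by (simp add: f_def fun_eq_iff)
      ultimately show ?thesis by metis
    qed
    then show "x = y" by (simp add: Finite_Cartesian_Product.vec_eq_iff)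
  qed
  ultimately show ?thesis using finite_imageD finite_subset by blast
qed

lemma finite_dilate_points:
  assumes "bounded S" "k > 0"
  shows "finite {z \<in> (int_points :: (real^'n) set). (1 / real k) *\<^sub>R z \<in> S}"
proof -
  obtain R where R: "\<And>x. x \<in> S \<Longrightarrow> norm x \<le> R" using assms(1) bounded_iff by blast
  have "norm z \<le> real k * R" if z: "(1 / real k) *\<^sub>R z \<in> S" for z
    using R[OF z] \<open>k > 0\<close> by (auto simp: field_simps)
  then have "{z \<in> int_points. (1 / real k) *\<^sub>R z \<in> S} \<subseteq> cball 0 (real k * R) \<inter> int_points" by auto
  then show ?thesis using finite_int_points_bounded finite_subset bounded_cball by blast
qed

text \<open>The facets opposite to the vertices in \<open>I\<close> are removed from the simplex. An integer point of a
dilate has barycentric coordinates that split uniquely into a nonnegative integer part and a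
fractional part in \<open>box_coords\<close>, where the unit intervals are open at \<open>0\<close> for the vertices in \<open>I\<close>.\<close>

definition half_open_simplex :: "(real^'n) set \<Rightarrow> (real^'n) set \<Rightarrow> (real^'n) set" where
  "half_open_simplex W I = {\<Sum>w\<in>W. l w *\<^sub>R w | l. sum l W = 1 \<and> (\<forall>w\<in>W. 0 \<le> l w \<and> (w \<in> I \<longrightarrow> 0 < l w))}"

definition box_coords :: "(real^'n) set \<Rightarrow> (real^'n) set \<Rightarrow> (real^'n \<Rightarrow> real) set" where
  "box_coords W I = {r \<in> extensional W. (\<forall>w\<in>W. if w \<in> I then 0 < r w \<and> r w \<le> 1 else 0 \<le> r w \<and> r w < 1) \<and>
     sum r W \<in> \<int> \<and> (\<Sum>w\<in>W. r w *\<^sub>R w) \<in> int_points}"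

lemma affine_coords_unique:
  fixes W :: "'a::real_vector set"
  assumes "finite W" "\<not> affine_dependent W" "sum l W = sum m W"
    "(\<Sum>w\<in>W. l w *\<^sub>R w) = (\<Sum>w\<in>W. m w *\<^sub>R w)" "w \<in> W"
  shows "l w = m w"
proof (rule ccontr)
  assume "l w \<noteq> m w"
  moreover have "sum (\<lambda>w. l w - m w) W = 0" "(\<Sum>w\<in>W. (l w - m w) *\<^sub>R w) = 0"
    using assms by (simp_all add: sum_subtractf scaleR_left_diff_distrib)
  ultimately have "affine_dependent W"
    unfolding affine_dependent_explicit_finite[OF assms(1)]
    using assms(5) by (intro exI[of _ "\<lambda>w. l w - m w"]) auto
  then show False using assms by simp
qed

text \<open>The height \<open>sum r W\<close> of a box point decides whether its binomial
  coefficient vanishes. The strict bound comes from a vertex outside \<open>I\<close>, whose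
  coordinate is less than 1.\<close>

lemma box_coords_sum_bounds:
  assumes "finite W" "W \<noteq> {}" "r \<in> box_coords W I"
  shows "0 \<le> sum r W" "sum r W \<le> real (card W)" "W \<noteq> I \<Longrightarrow> I \<subseteq> W \<Longrightarrow> sum r W < real (card W)"
proof -
  have r: "0 \<le> r w \<and> r w \<le> 1" if "w \<in> W" for w
    using assms(3) that unfolding box_coords_def by (auto split: if_splits dest!: bspec)
  show "0 \<le> sum r W" using r by (auto intro: sum_nonneg)
  show "sum r W \<le> real (card W)" using sum_bounded_above[of W r 1] r by auto
  assume "W \<noteq> I" "I \<subseteq> W"
  then obtain w where w: "w \<in> W" "w \<notin> I" by auto
  then have "r w < 1" using assms(3) unfolding box_coords_def by (auto split: if_splits dest!: bspec)
  then have "sum r W < sum (\<lambda>_. 1) W" using sum_strict_mono_ex1[OF assms(1), of r "\<lambda>_. 1"] r w by auto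
  then show "sum r W < real (card W)" by simp
qed

text \<open>By affine independence a box point is recovered from its height and the integer vector
  it represents; both range over finite sets.\<close>

lemma finite_box_coords:
  assumes "finite W" "\<not> affine_dependent W"
  shows "finite (box_coords W I)"
proof -
  define g where "g r = (\<lfloor>sum r W\<rfloor>, \<Sum>w\<in>W. r w *\<^sub>R w)" for r :: "real^'a \<Rightarrow> real"
  have r: "0 \<le> r w \<and> r w \<le> 1" if "w \<in> W" "r \<in> box_coords W I" for r w
    using that unfolding box_coords_def by (auto split: if_splits dest!: bspec)
  have "inj_on g (box_coords W I)"
  proof (rule inj_onI)
    fix r s assume *: "r \<in> box_coords W I" "s \<in> box_coords W I" "g r = g s"
    then have Z: "sum r W \<in> \<int>" "sum s W \<in> \<int>" and e: "r \<in> extensional W" "s \<in> extensional W"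
      by (auto simp: box_coords_def)
    have "\<lfloor>sum r W\<rfloor> = \<lfloor>sum s W\<rfloor>" using * by (simp add: g_def)
    then have "sum r W = sum s W" using Z by (metis of_int_floor)
    then have "r w = s w" if "w \<in> W" for w
      using affine_coords_unique[OF assms, of r s w] * that by (simp add: g_def)
    then show "r = s" using e by (metis extensionalityI)
  qed
  moreover have "g ` box_coords W I \<subseteq> {0..int (card W)} \<times> (cball 0 (sum norm W) \<inter> int_points)"
  proof safe
    fix r a z assume *: "r \<in> box_coords W I" "(a, z) = g r"
    show "z \<in> int_points" using * by (auto simp: g_def box_coords_def)
    have "norm z \<le> (\<Sum>w\<in>W. norm (r w *\<^sub>R w))" using * norm_sum[of "\<lambda>w. r w *\<^sub>R w" W] by (simp add: g_def)
    also have "\<dots> \<le> sum norm W" using r[OF _ *(1)] by (intro sum_mono) (simp add: mult_left_le_one_le)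
    finally show "z \<in> cball 0 (sum norm W)" by simp
    have "0 \<le> sum r W" "sum r W \<le> sum (\<lambda>_. 1) W" using r[OF _ *(1)] by (auto intro!: sum_nonneg sum_mono simp del: sum_constant)
    then show "a \<in> {0..int (card W)}" using * by (simp add: g_def) linarith
  qed
  moreover have "finite ({0..int (card W)} \<times> (cball 0 (sum norm W) \<inter> (int_points :: (real^'a) set)))"
    by (intro finite_cartesian_product finite_int_points_bounded) auto
  ultimately show ?thesis using finite_imageD finite_subset by blast
qed

text \<open>The points counted are the integer points at height \<open>k\<close> in the cone over
  the half-open simplex. Splitting off integer parts leaves a box point of some height
  \<open>h\<close>; the integer parts sum to \<open>k - h\<close>, and stars and bars counts them.
  With \<open>gchoose\<close> the result is a polynomial in \<open>k\<close>.\<close>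

lemma card_cone_slice:
  fixes W :: "(real^'n) set" and k :: nat
  assumes W: "finite W" "card W = Suc d" "\<not> affine_dependent W" "W \<subseteq> int_points" and I: "I \<subseteq> W" and k: "k \<ge> 1"
  shows "finite {z \<in> int_points. (1 / real k) *\<^sub>R z \<in> half_open_simplex W I}"
    and "real (card {z \<in> int_points. (1 / real k) *\<^sub>R z \<in> half_open_simplex W I}) =
      (\<Sum>r\<in>box_coords W I. (real k - sum r W + real d) gchoose d)"
proof -
  let ?Z = "{z \<in> int_points. (1 / real k) *\<^sub>R z \<in> half_open_simplex W I}"
  define C where "C r = {n \<in> W \<rightarrow>\<^sub>E (UNIV :: nat set). real (sum n W) + sum r W = real k}" for r
  define \<phi> where "\<phi> = (\<lambda>(r :: real^'n \<Rightarrow> real, n :: real^'n \<Rightarrow> nat). \<Sum>w\<in>W. (r w + real (n w)) *\<^sub>R w)"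
  have box: "if w \<in> I then 0 < r w \<and> r w \<le> 1 else 0 \<le> r w \<and> r w < 1" if "w \<in> W" "r \<in> box_coords W I" for r w
    using that unfolding box_coords_def by blast
  have hint: "sum r W \<in> \<int>" if "r \<in> box_coords W I" for r using that unfolding box_coords_def by blast
  have Wne: "W \<noteq> {}" using W by auto
  have cardC: "finite (C r) \<and> real (card (C r)) = (real k - sum r W + real d) gchoose d" if r: "r \<in> box_coords W I" for r
  proof -
    obtain h :: int where h: "sum r W = of_int h" using hint[OF r] by (auto elim: Ints_cases)
    have h0: "0 \<le> h" "h \<le> int d + 1" using box_coords_sum_bounds[OF W(1) Wne r] h W(2) by linarith+
    show ?thesis
    proof (cases "h \<le> int k")
      case True
      define N where "N = nat (int k - h)"
      have N: "real N = real k - sum r W" using True h by (simp add: N_def)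
      have "C r = {n \<in> W \<rightarrow>\<^sub>E (UNIV :: nat set). sum n W = N}"
      proof -
        have eq: "real (sum n W) + sum r W = real k \<longleftrightarrow> sum n W = N" for n :: "real^'n \<Rightarrow> nat"
          using N of_nat_eq_iff[of "sum n W" N, where 'a = real] by linarith
        show ?thesis unfolding C_def by (simp only: eq)
      qed
      then have "finite (C r)" "card (C r) = (N + d) choose d" using card_compositions[OF W(1,2), of N] by auto
      moreover have "real ((N + d) choose d) = (real k - sum r W + real d) gchoose d"
        unfolding binomial_gbinomial using N by simp
      ultimately show ?thesis by simp
    next
      case False
      have Cr: "C r = {}"
      proof -
        have "real (sum n W) + sum r W \<noteq> real k" for n :: "real^'n \<Rightarrow> nat"
          using False h by (metis of_int_le_iff of_int_of_nat_eq of_nat_0_le_iff le_add_same_cancel2)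
        then show ?thesis unfolding C_def by simp
      qed
      \<comment> \<open>A box point higher than \<open>k\<close> contributes no lattice point, and
        its polynomial vanishes as well: \<open>h <= d + 1\<close> and \<open>k >= 1\<close> give
        \<open>0 <= k - h + d < d\<close>.\<close>
      define M where "M = nat (int k - h + int d)"
      have M: "real M = real k - sum r W + real d" "M < d" using False h h0 k by (auto simp: M_def)
      have "(real k - sum r W + real d) gchoose d = real (M choose d)"
        unfolding binomial_gbinomial using M by simp
      also have "\<dots> = 0" using M by simp
      finally show ?thesis using Cr by simp
    qed
  qed
  have bij: "bij_betw \<phi> (Sigma (box_coords W I) C) ?Z"
    unfolding bij_betw_def
  proof
    show "inj_on \<phi> (Sigma (box_coords W I) C)"
    proof (rule inj_onI)
      fix p p' assume p: "p \<in> Sigma (box_coords W I) C" "p' \<in> Sigma (box_coords W I) C" "\<phi> p = \<phi> p'"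
      obtain r n r' n' where pp: "p = (r, n)" "p' = (r', n')" by fastforce
      have r: "r \<in> box_coords W I" "r' \<in> box_coords W I" and n: "n \<in> C r" "n' \<in> C r'" using p pp by auto
      have e: "r w + real (n w) = r' w + real (n' w)" if "w \<in> W" for w
      proof (rule affine_coords_unique[OF W(1,3) _ _ that])
        show "(\<Sum>w\<in>W. r w + real (n w)) = (\<Sum>w\<in>W. r' w + real (n' w))"
          using n by (simp add: C_def sum.distrib)
        show "(\<Sum>w\<in>W. (r w + real (n w)) *\<^sub>R w) = (\<Sum>w\<in>W. (r' w + real (n' w)) *\<^sub>R w)"
          using p(3) pp by (simp add: \<phi>_def)
      qed
      \<comment> \<open>Both fractional parts lie in the same half-open unit interval, so the
        integer parts agree.\<close>
      have nn: "n w = n' w" if "w \<in> W" for w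
        using e[OF that] box[OF that r(1)] box[OF that r(2)] by (auto split: if_splits)
      then have "n = n'" using n by (intro extensionalityI[of n W]) (auto simp: C_def PiE_def)
      moreover have "r = r'" using e nn r by (intro extensionalityI[of r W]) (auto simp: box_coords_def)
      ultimately show "p = p'" using pp by simp
    qed
    show "\<phi> ` Sigma (box_coords W I) C = ?Z"
    proof safe
      fix r n assume r: "r \<in> box_coords W I" and n: "n \<in> C r"
      have "\<phi> (r, n) = (\<Sum>w\<in>W. r w *\<^sub>R w) + (\<Sum>w\<in>W. real (n w) *\<^sub>R w)"
        by (simp add: \<phi>_def scaleR_left_distrib sum.distrib)
      moreover have "(\<Sum>w\<in>W. r w *\<^sub>R w) \<in> int_points" using r by (simp add: box_coords_def)
      moreover have "(\<Sum>w\<in>W. real (n w) *\<^sub>R w) \<in> int_points"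
        using W(4) by (intro int_points_sum int_points_scale) auto
      ultimately show "\<phi> (r, n) \<in> int_points" by (simp add: int_points_add)
      define l where "l w = (r w + real (n w)) / real k" for w
      have "sum l W = 1" using n k unfolding l_def by (simp add: C_def sum.distrib flip: sum_divide_distrib)
      moreover have "(1 / real k) *\<^sub>R \<phi> (r, n) = (\<Sum>w\<in>W. l w *\<^sub>R w)"
        by (simp add: \<phi>_def l_def scaleR_sum_right)
      moreover have "0 \<le> l w \<and> (w \<in> I \<longrightarrow> 0 < l w)" if "w \<in> W" for w
        using box[OF that r] k unfolding l_def by (auto split: if_splits intro!: divide_nonneg_pos divide_pos_pos add_pos_nonneg)
      ultimately show "(1 / real k) *\<^sub>R \<phi> (r, n) \<in> half_open_simplex W I"
        unfolding half_open_simplex_def by blast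
    next
      fix z assume z: "z \<in> int_points" "(1 / real k) *\<^sub>R z \<in> half_open_simplex W I"
      then obtain l where l: "(1 / real k) *\<^sub>R z = (\<Sum>w\<in>W. l w *\<^sub>R w)" "sum l W = 1"
        "\<And>w. w \<in> W \<Longrightarrow> 0 \<le> l w \<and> (w \<in> I \<longrightarrow> 0 < l w)" unfolding half_open_simplex_def by blast
      define m where "m w = real k * l w" for w
      have m: "sum m W = real k" "0 \<le> m w \<and> (w \<in> I \<longrightarrow> 0 < m w)" if "w \<in> W" for w
        using l(2) l(3)[OF that] k by (auto simp: m_def simp flip: sum_distrib_left)
      have mk: "sum m W = real k" using l(2) by (simp add: m_def flip: sum_distrib_left)
      have mz: "(\<Sum>w\<in>W. m w *\<^sub>R w) = z"
      proof -
        have "real k *\<^sub>R ((1 / real k) *\<^sub>R z) = (\<Sum>w\<in>W. m w *\<^sub>R w)"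
          unfolding l(1) by (simp add: m_def scaleR_sum_right)
        then show ?thesis using k by simp
      qed
      \<comment> \<open>For a vertex in \<open>I\<close> the fractional part must be positive and
        may equal 1, hence the ceiling minus one in place of the floor. \<open>nat\<close> loses
        nothing, because \<open>m w\<close> is positive on \<open>I\<close> and nonnegative
        elsewhere.\<close>
      define n where "n = (\<lambda>w\<in>W. nat (if w \<in> I then \<lceil>m w\<rceil> - 1 else \<lfloor>m w\<rfloor>))"
      define r where "r = (\<lambda>w\<in>W. m w - real (n w))"
      have rb: "if w \<in> I then 0 < r w \<and> r w \<le> 1 else 0 \<le> r w \<and> r w < 1" if "w \<in> W" for w
      proof (cases "w \<in> I")
        case True
        then have "real (n w) = of_int (\<lceil>m w\<rceil> - 1)" using m(2)[OF that] that by (simp add: n_def)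
        then show ?thesis using True that by (simp add: r_def) linarith
      next
        case False
        then have "real (n w) = of_int \<lfloor>m w\<rfloor>" using m(2)[OF that] that by (simp add: n_def)
        then show ?thesis using False that by (simp add: r_def) linarith
      qed
      have sr: "sum r W = real k - real (sum n W)" using mk by (simp add: r_def sum_subtractf)
      have zr: "(\<Sum>w\<in>W. r w *\<^sub>R w) = z - (\<Sum>w\<in>W. real (n w) *\<^sub>R w)"
        using mz by (simp add: r_def sum_subtractf scaleR_left_diff_distrib)
      have "(\<Sum>w\<in>W. real (n w) *\<^sub>R w) \<in> int_points"
        using W(4) by (intro int_points_sum int_points_scale) auto
      then have "(\<Sum>w\<in>W. r w *\<^sub>R w) \<in> int_points" unfolding zr using z(1) by (intro int_points_diff)
      moreover have "sum r W \<in> \<int>" unfolding sr by (intro Ints_diff Ints_of_nat)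
      moreover have "r \<in> extensional W" by (simp add: r_def)
      ultimately have "r \<in> box_coords W I" unfolding box_coords_def using rb by blast
      moreover have "n \<in> C r" unfolding C_def using sr by (auto simp: n_def)
      moreover have "\<phi> (r, n) = z" using mz by (simp add: \<phi>_def r_def)
      ultimately show "z \<in> \<phi> ` Sigma (box_coords W I) C" by force
    qed
  qed
  then have b: "finite ?Z = finite (Sigma (box_coords W I) C)" "card ?Z = card (Sigma (box_coords W I) C)"
    using bij_betw_finite[OF bij] bij_betw_same_card[OF bij] by simp_all
  note fb = finite_box_coords[OF W(1,3), of I]
  show "finite ?Z" using b fb cardC by auto
  show "real (card ?Z) = (\<Sum>r\<in>box_coords W I. (real k - sum r W + real d) gchoose d)"
    using b fb cardC by (simp add: card_SigmaI)
qed

text \<open>Reflection exchanges the unit intervals open at 0 with those open at 1. Integrality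
  survives because the height is subtracted from \<open>card W\<close> and the represented vector
  from the sum of the vertices.\<close>

lemma box_coords_complement:
  assumes "finite W" "W \<subseteq> int_points" "I \<subseteq> W"
  shows "bij_betw (\<lambda>r. \<lambda>w\<in>W. 1 - r w) (box_coords W I) (box_coords W (W - I))"
proof -
  have *: "(\<lambda>w\<in>W. 1 - r w) \<in> box_coords W (W - J)" if r: "r \<in> box_coords W J" and "J \<subseteq> W" for r J
  proof -
    let ?s = "\<lambda>w\<in>W. 1 - r w"
    have "sum ?s W = real (card W) - sum r W" by (simp add: sum_subtractf)
    moreover have "(\<Sum>w\<in>W. ?s w *\<^sub>R w) = \<Sum>W - (\<Sum>w\<in>W. r w *\<^sub>R w)"
      by (simp add: sum_subtractf scaleR_left_diff_distrib)
    moreover have "\<Sum>W \<in> int_points" using assms by (intro int_points_sum) auto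
    moreover have "if w \<in> W - J then 0 < ?s w \<and> ?s w \<le> 1 else 0 \<le> ?s w \<and> ?s w < 1" if "w \<in> W" for w
      using r that unfolding box_coords_def by (auto dest!: bspec split: if_splits)
    ultimately show ?thesis using r unfolding box_coords_def by (auto intro: int_points_diff)
  qed
  have inv: "(\<lambda>w\<in>W. 1 - (\<lambda>w\<in>W. 1 - r w) w) = r" if "r \<in> box_coords W J" for r J
    using that by (auto simp: box_coords_def extensional_def fun_eq_iff)
  have WW: "W - (W - I) = I" using assms by auto
  show ?thesis
    by (rule bij_betwI[where g = "\<lambda>r. \<lambda>w\<in>W. 1 - r w"])
       (use *[OF _ assms(3)] *[of _ "W - I"] inv WW in \<open>auto simp del: restrict_apply\<close>)
qed

text \<open>Reflection turns height \<open>h\<close> into \<open>d + 1 - h\<close>, so the upper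
  index becomes \<open>y + h - 1\<close>. Upper negation, \<open>gbinomial_minus\<close> at
  \<open>y + h - d\<close>, changes it to \<open>- y - h + d\<close> at the cost of the sign. This
  is Ehrhart reciprocity for one half-open simplex.\<close>

lemma box_coords_reciprocity:
  fixes W :: "(real^'n) set"
  assumes "finite W" "card W = Suc d" "W \<subseteq> int_points" "I \<subseteq> W"
  shows "(\<Sum>r\<in>box_coords W (W - I). (y - sum r W + real d) gchoose d) =
    (-1)^d * (\<Sum>r\<in>box_coords W I. (- y - sum r W + real d) gchoose d)"
proof -
  have "(\<Sum>r\<in>box_coords W (W - I). (y - sum r W + real d) gchoose d) =
    (\<Sum>r\<in>box_coords W I. (y - sum (\<lambda>w\<in>W. 1 - r w) W + real d) gchoose d)"
    by (rule sum.reindex_bij_betw[OF box_coords_complement[OF assms(1,3,4)], symmetric])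
  also have "\<dots> = (\<Sum>r\<in>box_coords W I. (-1)^d * ((- y - sum r W + real d) gchoose d))"
  proof (rule sum.cong[OF refl])
    fix r
    have "(- (y + sum r W - real d)) gchoose d = (-1)^d * ((y + sum r W - real d + real d - 1) gchoose d)"
      by (rule gbinomial_minus)
    moreover have "- (y + sum r W - real d) = - y - sum r W + real d" by simp
    moreover have "y + sum r W - real d + real d - 1 = y - sum (\<lambda>w\<in>W. 1 - r w) W + real d"
      using assms(2) by (simp add: sum_subtractf)
    ultimately have e: "(- y - sum r W + real d) gchoose d = (-1)^d * ((y - sum (\<lambda>w\<in>W. 1 - r w) W + real d) gchoose d)"
      by metis
    show "(y - sum (\<lambda>w\<in>W. 1 - r w) W + real d) gchoose d = (-1)^d * ((- y - sum r W + real d) gchoose d)"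
      unfolding e by (simp flip: mult.assoc power_add)
  qed
  also have "\<dots> = (-1)^d * (\<Sum>r\<in>box_coords W I. (- y - sum r W + real d) gchoose d)"
    by (simp add: sum_distrib_left)
  finally show ?thesis .
qed

section \<open>Lebesgue measure on a linear subspace\<close>

lemma sum_in_span: "(\<Sum>b\<in>C. c b *\<^sub>R b) \<in> span C"
  by (intro span_sum span_scale span_base)

lemma orthonormal_basis_exists:
  assumes "subspace (V :: 'a::euclidean_space set)"
  shows "\<exists>B. orthonormal_basis_of B V"
  using orthonormal_basis_subspace[OF assms] unfolding orthonormal_basis_of_def by metis

lemma orthonormal_basis_props:
  assumes "orthonormal_basis_of B (V :: 'a::euclidean_space set)"
  shows "finite B" "independent B" "span B = V" "card B = dim V"
    "\<And>b. b \<in> B \<Longrightarrow> inner b b = 1" "\<And>b b'. b \<in> B \<Longrightarrow> b' \<in> B \<Longrightarrow> b \<noteq> b' \<Longrightarrow> inner b b' = 0"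
proof -
  have n: "norm b = 1" if "b \<in> B" for b using that assms by (simp add: orthonormal_basis_of_def)
  then have "0 \<notin> B" by force
  then show ind: "independent B"
    using assms pairwise_orthogonal_independent by (auto simp: orthonormal_basis_of_def)
  then show "finite B" by (simp add: finiteI_independent)
  show s: "span B = V" using assms by (simp add: orthonormal_basis_of_def)
  show "card B = dim V" using ind s by (metis dim_span dim_eq_card_independent)
  show "inner b b = 1" if "b \<in> B" for b using n[OF that] by (simp add: norm_eq_1)
  show "inner b b' = 0" if "b \<in> B" "b' \<in> B" "b \<noteq> b'" for b b'
    using assms that by (auto simp: orthonormal_basis_of_def pairwise_def real_inner_class.orthogonal_def)
qed

abbreviation span_lborel :: "'a::euclidean_space set \<Rightarrow> 'a measure" where
  "span_lborel B \<equiv> flat_lborel 0 B"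

lemma sets_flat_lborel [simp, measurable_cong]: "sets (flat_lborel a B) = sets borel"
  by (simp add: flat_lborel_def)

lemma space_flat_lborel [simp]: "space (flat_lborel a B) = UNIV"
  by (simp add: flat_lborel_def)

lemma flat_coords_measurable [measurable]:
  assumes "finite B"
  shows "(\<lambda>f. a + (\<Sum>b\<in>B. f b *\<^sub>R b)) \<in> measurable (Pi\<^sub>M B (\<lambda>_. lborel)) (borel :: 'a::euclidean_space measure)"
  by measurable

lemma emeasure_flat_lborel:
  fixes S :: "'a::euclidean_space set"
  assumes "finite B" "S \<in> sets borel"
  shows "emeasure (flat_lborel a B) S =
    emeasure (Pi\<^sub>M B (\<lambda>_. lborel)) {f \<in> B \<rightarrow>\<^sub>E UNIV. a + (\<Sum>b\<in>B. f b *\<^sub>R b) \<in> S}"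
  unfolding flat_lborel_def
  by (subst emeasure_distr[OF flat_coords_measurable[OF assms(1)] assms(2)])
     (auto simp: space_PiM PiE_def intro!: arg_cong[where f = "emeasure _"])

lemma flat_lborel_translate:
  fixes S :: "'a::euclidean_space set"
  assumes "finite B" "S \<in> sets borel"
  shows "emeasure (flat_lborel a B) S = emeasure (span_lborel B) {x. a + x \<in> S}"
proof -
  have "{x. a + x \<in> S} \<in> sets borel"
    using measurable_sets[of "(+) a" borel borel S] assms(2) by (simp add: vimage_def)
  then show ?thesis using assms by (simp add: emeasure_flat_lborel)
qed

interpretation lborel_product: product_sigma_finite "\<lambda>_. lborel :: real measure"
  by standard

text \<open>The product measure is determined by its values on boxes, where each coordinate
  contributes one factor \<open>c\<close> by the one-dimensional change of variables.\<close>

lemma PiM_lborel_affine: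
  fixes w :: "'a \<Rightarrow> real"
  assumes "finite B" "c > 0"
  shows "Pi\<^sub>M B (\<lambda>_. lborel) = scale_measure (ennreal (c ^ card B))
    (distr (Pi\<^sub>M B (\<lambda>_. lborel)) (Pi\<^sub>M B (\<lambda>_. lborel)) (\<lambda>f. \<lambda>b\<in>B. w b + c * f b))"
proof (rule lborel_product.PiM_eqI[OF assms(1), symmetric])
  let ?P = "Pi\<^sub>M B (\<lambda>_. lborel :: real measure)"
  let ?g = "\<lambda>f. \<lambda>b\<in>B. w b + c * f b"
  show "sets (scale_measure (ennreal (c ^ card B)) (distr ?P ?P ?g)) = sets ?P" by simp
  fix A :: "'a \<Rightarrow> real set" assume A: "\<And>b. b \<in> B \<Longrightarrow> A b \<in> sets lborel"
  have g: "?g \<in> measurable ?P ?P" by measurable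
  have AB: "Pi\<^sub>E B A \<in> sets ?P" using A assms(1) by (intro sets_PiM_I_finite) auto
  have one: "ennreal c * emeasure lborel {x. w b + c * x \<in> A b} = emeasure lborel (A b)" 
    and meas: "{x. w b + c * x \<in> A b} \<in> sets lborel" if b: "b \<in> B" for b
  proof -
    have Ab: "A b \<in> sets borel" using A[OF b] by simp
    have m: "(\<lambda>x. w b + c * x) \<in> measurable lborel borel" by measurable
    have "emeasure lborel (A b) = emeasure (density (distr lborel borel (\<lambda>x. w b + c * x)) (\<lambda>_. ennreal (abs c))) (A b)"
      using lborel_real_affine[of c "w b"] assms(2) by simp
    also have "\<dots> = ennreal (abs c) * emeasure (distr lborel borel (\<lambda>x. w b + c * x)) (A b)"
      using Ab by (intro emeasure_density_const) simp
    also have "\<dots> = ennreal c * emeasure lborel {x. w b + c * x \<in> A b}"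
      using assms(2) Ab by (subst emeasure_distr[OF m]) (simp_all add: vimage_def)
    finally show "ennreal c * emeasure lborel {x. w b + c * x \<in> A b} = emeasure lborel (A b)" by simp
    show "{x. w b + c * x \<in> A b} \<in> sets lborel"
      using measurable_sets[OF m Ab] by (simp add: vimage_def)
  qed
  have pre: "?g -` Pi\<^sub>E B A \<inter> space ?P = Pi\<^sub>E B (\<lambda>b. {x. w b + c * x \<in> A b})"
    by (auto simp: space_PiM PiE_def Pi_def extensional_def)
  have "emeasure (scale_measure (ennreal (c ^ card B)) (distr ?P ?P ?g)) (Pi\<^sub>E B A) =
    ennreal (c ^ card B) * emeasure ?P (Pi\<^sub>E B (\<lambda>b. {x. w b + c * x \<in> A b}))"
    using emeasure_distr[OF g AB] pre by simp
  also have "\<dots> = ennreal c ^ card B * (\<Prod>b\<in>B. emeasure lborel {x. w b + c * x \<in> A b})"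
    using lborel_product.emeasure_PiM[OF assms(1), of "\<lambda>b. {x. w b + c * x \<in> A b}"] meas assms(2)
    by (simp add: ennreal_power)
  also have "\<dots> = (\<Prod>b\<in>B. ennreal c * emeasure lborel {x. w b + c * x \<in> A b})"
    by (simp add: prod.distrib)
  also have "\<dots> = (\<Prod>b\<in>B. emeasure lborel (A b))" using one by simp
  finally show "emeasure (scale_measure (ennreal (c ^ card B)) (distr ?P ?P ?g)) (Pi\<^sub>E B A) =
    (\<Prod>b\<in>B. emeasure lborel (A b))" .
qed

text \<open>Used with \<open>c = 1\<close> as translation invariance along the subspace and with
  other \<open>c\<close> to scale dilates. The measure is concentrated on \<open>span B\<close>,
  hence the restriction on \<open>u\<close>.\<close>

lemma span_lborel_affine:
  fixes S :: "'a::euclidean_space set"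
  assumes "finite B" "c > 0" "u \<in> span B" "S \<in> sets borel"
  shows "emeasure (span_lborel B) S = ennreal (c ^ card B) * emeasure (span_lborel B) {x. u + c *\<^sub>R x \<in> S}"
proof -
  let ?P = "Pi\<^sub>M B (\<lambda>_. lborel :: real measure)"
  obtain w where w: "u = (\<Sum>b\<in>B. w b *\<^sub>R b)" using assms(3) span_finite[OF assms(1)] by auto
  let ?g = "\<lambda>f. \<lambda>b\<in>B. w b + c * f b"
  have g: "?g \<in> measurable ?P ?P" by measurable
  let ?A = "{f \<in> B \<rightarrow>\<^sub>E UNIV. (\<Sum>b\<in>B. f b *\<^sub>R b) \<in> S}"
  have A: "?A \<in> sets ?P"
    using measurable_sets[OF flat_coords_measurable[OF assms(1), of 0] assms(4)]
    by (simp add: vimage_def space_PiM PiE_def Int_def conj_commute)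
  have gs: "(\<Sum>b\<in>B. ?g f b *\<^sub>R b) = u + c *\<^sub>R (\<Sum>b\<in>B. f b *\<^sub>R b)" for f
    by (simp add: w scaleR_left_distrib sum.distrib scaleR_sum_right)
  have pre: "?g -` ?A \<inter> space ?P = {f \<in> B \<rightarrow>\<^sub>E UNIV. (\<Sum>b\<in>B. f b *\<^sub>R b) \<in> {x. u + c *\<^sub>R x \<in> S}}"
    using gs by (auto simp: space_PiM PiE_def)
  have Sb: "{x. u + c *\<^sub>R x \<in> S} \<in> sets borel"
    using measurable_sets[of "\<lambda>x. u + c *\<^sub>R x" borel borel S] assms(4) by (simp add: vimage_def)
  have "emeasure (span_lborel B) S = emeasure ?P ?A"
    using emeasure_flat_lborel[OF assms(1,4), of 0] by simp
  also have "\<dots> = ennreal (c ^ card B) * emeasure (distr ?P ?P ?g) ?A"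
    by (subst PiM_lborel_affine[OF assms(1,2), of w]) simp
  also have "emeasure (distr ?P ?P ?g) ?A = emeasure (span_lborel B) {x. u + c *\<^sub>R x \<in> S}"
    using emeasure_distr[OF g A] pre emeasure_flat_lborel[OF assms(1) Sb, of 0] by simp
  finally show ?thesis .
qed

text \<open>Coordinates in an orthonormal basis are inner products with unit vectors, so by
  Cauchy-Schwarz those of a bounded set lie in a cube of finite volume.\<close>

lemma span_lborel_bounded:
  assumes B: "orthonormal_basis_of B V" and "bounded S" "S \<in> sets borel"
  shows "emeasure (span_lborel B) S < \<infinity>"
proof -
  note Bp = orthonormal_basis_props[OF B]
  obtain R where R: "\<And>x. x \<in> S \<Longrightarrow> norm x \<le> R" using assms(2) bounded_iff by blast
  have "emeasure (span_lborel B) S \<le> emeasure (Pi\<^sub>M B (\<lambda>_. lborel)) (Pi\<^sub>E B (\<lambda>_. {-R..R}))"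
    unfolding emeasure_flat_lborel[OF Bp(1) assms(3)]
  proof (rule emeasure_mono)
    show "{f \<in> B \<rightarrow>\<^sub>E UNIV. 0 + (\<Sum>b\<in>B. f b *\<^sub>R b) \<in> S} \<subseteq> Pi\<^sub>E B (\<lambda>_. {-R..R})"
    proof safe
      fix f b assume f: "0 + (\<Sum>b\<in>B. f b *\<^sub>R b) \<in> S" "f \<in> B \<rightarrow>\<^sub>E UNIV"
      show "f b \<in> {-R..R}" if b: "b \<in> B"
      proof -
        have "inner (\<Sum>b'\<in>B. f b' *\<^sub>R b') b = (\<Sum>b'\<in>B. if b' = b then f b else 0)"
          unfolding inner_sum_left using Bp(5,6) b by (intro sum.cong) auto
        then have "f b = inner (\<Sum>b'\<in>B. f b' *\<^sub>R b') b" using Bp(1) b by simp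
        moreover have "norm b = 1" using Bp(5)[OF b] by (simp add: norm_eq_1)
        ultimately have "\<bar>f b\<bar> \<le> norm (\<Sum>b'\<in>B. f b' *\<^sub>R b')"
          using Cauchy_Schwarz_ineq2[of "\<Sum>b'\<in>B. f b' *\<^sub>R b'" b] by simp
        also have "\<dots> \<le> R" using R f by simp
        finally show ?thesis by (simp add: abs_le_iff)
      qed
      show "b \<notin> B \<Longrightarrow> f b = undefined" using f by (auto simp: PiE_def extensional_def)
    qed
    show "Pi\<^sub>E B (\<lambda>_. {-R..R}) \<in> sets (Pi\<^sub>M B (\<lambda>_. lborel))" using Bp(1) by (intro sets_PiM_I_finite) auto
  qed
  also have "\<dots> = (\<Prod>b\<in>B. emeasure lborel {-R..R})"
    by (rule lborel_product.emeasure_PiM[OF Bp(1)]) auto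
  also have "\<dots> < \<infinity>" by (auto simp: less_top[symmetric] power_eq_top_ennreal emeasure_lborel_Icc_eq)
  finally show ?thesis .
qed

text \<open>This serves to exclude a null cell in \<open>emeasure_cell_pos\<close>. Dimension 0 is
  included, where the empty product of measures is 1.\<close>

lemma span_lborel_span_pos:
  assumes "orthonormal_basis_of B V"
  shows "emeasure (span_lborel B) V \<noteq> 0"
proof -
  note Bp = orthonormal_basis_props[OF assms]
  have V: "V \<in> sets borel" using Bp(3) closed_subspace[of V] subspace_span by (auto intro: borel_closed)
  have "{f \<in> B \<rightarrow>\<^sub>E UNIV. 0 + (\<Sum>b\<in>B. f b *\<^sub>R b) \<in> V} = Pi\<^sub>E B (\<lambda>_. UNIV)"
    using Bp(3) sum_in_span[of _ B] by auto
  then have "emeasure (span_lborel B) V = (\<Prod>b\<in>B. emeasure lborel (UNIV :: real set))"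
    unfolding emeasure_flat_lborel[OF Bp(1) V]
    using lborel_product.emeasure_PiM[OF Bp(1), of "\<lambda>_. UNIV"] by simp
  also have "\<dots> \<noteq> 0" by (simp add: prod_zero_iff Bp(1))
  finally show ?thesis .
qed

text \<open>The origin chosen inside \<open>rel_volume\<close> differs from \<open>v\<close> by a
  vector of the span, so translation invariance exchanges the two. The basis stays the
  \<open>SOME\<close> term determined by \<open>V\<close>: a facet and the cell of its lattice have
  the same \<open>V\<close>, hence are measured in one and the same basis.\<close>

lemma rel_volume_span_lborel:
  fixes S :: "'a::euclidean_space set"
  assumes S: "S \<in> sets borel" and v: "v \<in> S" and V: "V = span {x - y | x y. x \<in> S \<and> y \<in> S}"
    and B: "B = (SOME B. orthonormal_basis_of B V)"
  shows "rel_volume S = measure (span_lborel B) {x. v + x \<in> S}"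
proof -
  define a where "a = (SOME a. a \<in> S)"
  have a: "a \<in> S" unfolding a_def using v by (rule someI)
  have "orthonormal_basis_of B V" unfolding B
    by (rule someI_ex, rule orthonormal_basis_exists) (simp add: V)
  note Bp = orthonormal_basis_props[OF this]
  have u: "a - v \<in> span B" using Bp(3) V a v by (auto intro: span_base)
  have Sv: "{x. v + x \<in> S} \<in> sets borel"
    using measurable_sets[of "(+) v" borel borel S] S by (simp add: vimage_def)
  have "emeasure (flat_lborel a B) S = emeasure (span_lborel B) {x. a + x \<in> S}"
    by (rule flat_lborel_translate[OF Bp(1) S])
  also have "{x. a + x \<in> S} = {x. (a - v) + 1 *\<^sub>R x \<in> {x. v + x \<in> S}}" by (simp add: algebra_simps)
  also have "emeasure (span_lborel B) \<dots> = emeasure (span_lborel B) {x. v + x \<in> S}"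
    using span_lborel_affine[OF Bp(1) _ u Sv, of 1] by simp
  finally show ?thesis
    unfolding rel_volume_def Let_def a_def[symmetric] V[symmetric] B[symmetric] by (simp add: measure_def)
qed

section \<open>Counting lattice points by tiling\<close>

text \<open>The coordinate functionals are extended to the whole space. Being linear they are
  continuous, so they serve both to show that cells are Borel sets and to compare
  coefficients.\<close>

lemma independent_coords:
  fixes C :: "'a::euclidean_space set"
  assumes "independent C"
  shows "\<exists>G. \<forall>b\<in>C. linear (G b) \<and> (\<forall>c. G b (\<Sum>x\<in>C. c x *\<^sub>R x) = (c b :: real))"
proof -
  have fin: "finite C" using assms by (simp add: finiteI_independent)
  have "\<exists>g. linear g \<and> (\<forall>c. g (\<Sum>x\<in>C. c x *\<^sub>R x) = (c b :: real))" if b: "b \<in> C" for b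
  proof -
    obtain g :: "'a \<Rightarrow> real" where g: "linear g" "\<And>x. x \<in> C \<Longrightarrow> g x = (if x = b then 1 else 0)"
      using linear_independent_extend[OF assms, of "\<lambda>x. if x = b then 1 else 0"] by blast
    have "g (\<Sum>x\<in>C. c x *\<^sub>R x) = c b" for c
    proof -
      have "g (\<Sum>x\<in>C. c x *\<^sub>R x) = (\<Sum>x\<in>C. c x * g x)"
        by (simp add: linear_sum[OF g(1)] linear_cmul[OF g(1)])
      also have "\<dots> = (\<Sum>x\<in>C. if x = b then c b else 0)" using g(2) by (intro sum.cong) auto
      finally show ?thesis using fin b by simp
    qed
    then show ?thesis using g(1) by blast
  qed
  then show ?thesis by metis
qed

text \<open>The cell is cut out of the closed subspace \<open>span C\<close> by finitely many
  half-open slabs of continuous functionals.\<close>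

lemma fund_parallelepiped_borel:
  fixes C :: "'a::euclidean_space set"
  assumes "independent C"
  shows "fund_parallelepiped C \<in> sets borel"
proof -
  have fin: "finite C" using assms by (simp add: finiteI_independent)
  obtain G where G: "\<And>b. b \<in> C \<Longrightarrow> linear (G b)" "\<And>b c. b \<in> C \<Longrightarrow> G b (\<Sum>x\<in>C. c x *\<^sub>R x) = (c b :: real)"
    using independent_coords[OF assms] by blast
  have eq: "fund_parallelepiped C = span C \<inter> {x. \<forall>b\<in>C. 0 \<le> G b x \<and> G b x < 1}" (is "?L = ?R")
  proof
    show "?L \<subseteq> ?R" unfolding fund_parallelepiped_def using G(2) sum_in_span[of _ C] by auto
    show "?R \<subseteq> ?L"
    proof
      fix x assume x: "x \<in> ?R"
      then obtain c where c: "x = (\<Sum>b\<in>C. c b *\<^sub>R b)" using span_finite[OF fin] by auto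
      have "0 \<le> c b \<and> c b < 1" if "b \<in> C" for b using x G(2)[OF that, of c] that c by auto
      then show "x \<in> ?L" unfolding fund_parallelepiped_def using c by blast
    qed
  qed
  have "G b \<in> borel_measurable borel" if "b \<in> C" for b
    using G(1)[OF that] by (intro borel_measurable_continuous_onI linear_continuous_on linear_conv_bounded_linear[THEN iffD1])
  then have "{x \<in> space borel. \<forall>b\<in>C. 0 \<le> G b x \<and> G b x < 1} \<in> sets borel"
    using fin by (intro sets.sets_Collect_finite_All sets.sets_Collect_conj) (auto intro: borel_measurable_le borel_measurable_less)
  moreover have "span C \<in> sets borel" by (intro borel_closed closed_subspace subspace_span)
  ultimately show ?thesis unfolding eq by (auto intro: sets.Int)
qed

lemma fund_parallelepiped_bounded:
  fixes C :: "'a::euclidean_space set"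
  assumes "finite C" "x \<in> fund_parallelepiped C"
  shows "norm x \<le> sum norm C"
proof -
  obtain c where c: "x = (\<Sum>b\<in>C. c b *\<^sub>R b)" "\<And>b. b \<in> C \<Longrightarrow> 0 \<le> c b \<and> c b < 1"
    using assms(2) by (auto simp: fund_parallelepiped_def)
  have "norm x \<le> (\<Sum>b\<in>C. norm (c b *\<^sub>R b))" unfolding c(1) by (rule norm_sum)
  also have "\<dots> \<le> sum norm C" using c(2) by (intro sum_mono) (auto simp: mult_left_le_one_le less_imp_le)
  finally show ?thesis .
qed

lemma fund_parallelepiped_span:
  "fund_parallelepiped C \<subseteq> span C"
  unfolding fund_parallelepiped_def using sum_in_span by auto

lemma zero_in_fund_parallelepiped: "0 \<in> fund_parallelepiped C"
  unfolding fund_parallelepiped_def by (rule CollectI, rule exI[of _ "\<lambda>_. 0"]) auto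

lemma lattice_tiles_cover:
  fixes C :: "'a::euclidean_space set"
  assumes "lattice_basis C L" "x \<in> span C"
  shows "\<exists>z\<in>L. x - z \<in> fund_parallelepiped C"
proof -
  have fin: "finite C" using assms by (simp add: lattice_basis_def finiteI_independent)
  obtain c where c: "x = (\<Sum>b\<in>C. c b *\<^sub>R b)" using assms(2) span_finite[OF fin] by auto
  define z where "z = (\<Sum>b\<in>C. of_int \<lfloor>c b\<rfloor> *\<^sub>R b)"
  have "z \<in> L" unfolding z_def using assms(1) by (auto simp: lattice_basis_def)
  moreover have "x - z = (\<Sum>b\<in>C. frac (c b) *\<^sub>R b)"
    by (simp add: c z_def frac_def scaleR_left_diff_distrib sum_subtractf)
  then have "x - z \<in> fund_parallelepiped C"
    unfolding fund_parallelepiped_def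
    by (intro CollectI exI[of _ "\<lambda>b. frac (c b)"] conjI ballI) (auto simp: frac_lt_1)
  ultimately show ?thesis by blast
qed

text \<open>Coefficients in \<open>[0, 1)\<close> that differ by an integer are equal, so a point
  determines the lattice point of its tile.\<close>

lemma lattice_tiles_disjoint:
  fixes C :: "'a::euclidean_space set"
  assumes "lattice_basis C L"
  shows "disjoint_family_on (\<lambda>z. {x. x - z \<in> fund_parallelepiped C}) L"
proof -
  have ind: "independent C" using assms by (simp add: lattice_basis_def)
  obtain G where G: "\<And>b. b \<in> C \<Longrightarrow> linear (G b)" "\<And>b c. b \<in> C \<Longrightarrow> G b (\<Sum>x\<in>C. c x *\<^sub>R x) = (c b :: real)"
    using independent_coords[OF ind] by blast
  have "z = z'" if z: "z \<in> L" "z' \<in> L" and x: "x - z \<in> fund_parallelepiped C" "x - z' \<in> fund_parallelepiped C" for x z z'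
  proof -
    obtain m m' :: "'a \<Rightarrow> int" where m: "z = (\<Sum>b\<in>C. of_int (m b) *\<^sub>R b)" "z' = (\<Sum>b\<in>C. of_int (m' b) *\<^sub>R b)"
      using assms z unfolding lattice_basis_def by auto
    obtain c c' where c: "x - z = (\<Sum>b\<in>C. c b *\<^sub>R b)" "x - z' = (\<Sum>b\<in>C. c' b *\<^sub>R b)"
      and cb: "\<And>b. b \<in> C \<Longrightarrow> 0 \<le> c b \<and> c b < 1" "\<And>b. b \<in> C \<Longrightarrow> 0 \<le> c' b \<and> c' b < 1"
      using x unfolding fund_parallelepiped_def by auto
    have "m b = m' b" if b: "b \<in> C" for b
    proof -
      have "G b (x - z) + G b z = G b (x - z') + G b z'"
        using linear_diff[OF G(1)[OF b]] by simp
      then have "c b + of_int (m b) = c' b + of_int (m' b)" using G(2)[OF b] c m by simp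
      then show ?thesis using cb[OF b] by linarith
    qed
    then show ?thesis using m by simp
  qed
  then show ?thesis unfolding disjoint_family_on_def by blast
qed

text \<open>The condition \<open>span C = V\<close> gives the lattice full rank, so that the tiles
  cover \<open>V\<close>. Integrality makes the number of lattice points in a bounded set
  finite.\<close>

locale lattice_flat =
  fixes V :: "(real^'n) set" and B C L :: "(real^'n) set"
  assumes onb: "orthonormal_basis_of B V"
    and basis: "lattice_basis C L"
    and spanC: "span C = V"
    and integral: "L \<subseteq> int_points"
begin

lemmas onb_props = orthonormal_basis_props[OF onb]

lemma indC: "independent C" and finC: "finite C"
  using basis by (auto simp: lattice_basis_def finiteI_independent)

lemma L_subset_V: "L \<subseteq> V"
  using basis spanC unfolding lattice_basis_def using sum_in_span by auto

abbreviation "\<mu> \<equiv> span_lborel B"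
abbreviation "cell \<equiv> fund_parallelepiped C"

lemma tile_borel: "{x. x - z \<in> cell} \<in> sets borel"
  using measurable_sets[of "\<lambda>x. x - z" borel borel cell] fund_parallelepiped_borel[OF indC]
  by (simp add: vimage_def)

lemma emeasure_tile:
  assumes "z \<in> L"
  shows "emeasure \<mu> {x. x - z \<in> cell} = emeasure \<mu> cell"
proof -
  have "- z \<in> span B" using assms L_subset_V onb_props(3) by (auto intro: span_neg)
  then show ?thesis
    using span_lborel_affine[OF onb_props(1) _ _ fund_parallelepiped_borel[OF indC], of 1 "- z"] by simp
qed

lemma tiles_inside:
  assumes "finite Z" "Z \<subseteq> L" "Y \<in> sets borel" "\<And>z x. z \<in> Z \<Longrightarrow> x - z \<in> cell \<Longrightarrow> x \<in> Y"
  shows "of_nat (card Z) * emeasure \<mu> cell \<le> emeasure \<mu> Y"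
proof -
  have "of_nat (card Z) * emeasure \<mu> cell = (\<Sum>z\<in>Z. emeasure \<mu> {x. x - z \<in> cell})"
    using emeasure_tile assms(2) by (simp add: subset_iff)
  also have "\<dots> = emeasure \<mu> (\<Union>z\<in>Z. {x. x - z \<in> cell})"
    using assms(1,2) tile_borel disjoint_family_on_mono[OF _ lattice_tiles_disjoint[OF basis]]
    by (intro sum_emeasure) auto
  also have "\<dots> \<le> emeasure \<mu> Y" using assms(3,4) by (intro emeasure_mono) auto
  finally show ?thesis .
qed

lemma tiles_covering:
  assumes "finite Z" "Z \<subseteq> L" "Y \<subseteq> (\<Union>z\<in>Z. {x. x - z \<in> cell})"
  shows "emeasure \<mu> Y \<le> of_nat (card Z) * emeasure \<mu> cell"
proof -
  have "emeasure \<mu> Y \<le> emeasure \<mu> (\<Union>z\<in>Z. {x. x - z \<in> cell})"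
    using assms tile_borel by (intro emeasure_mono sets.finite_UN) auto
  also have "\<dots> \<le> (\<Sum>z\<in>Z. emeasure \<mu> {x. x - z \<in> cell})"
    using assms(1) tile_borel by (intro emeasure_subadditive_finite) auto
  also have "\<dots> = of_nat (card Z) * emeasure \<mu> cell"
    using emeasure_tile assms(2) by (simp add: subset_iff)
  finally show ?thesis .
qed

lemma emeasure_cell_finite: "emeasure \<mu> cell < \<infinity>"
proof (rule span_lborel_bounded[OF onb _ fund_parallelepiped_borel[OF indC]])
  show "bounded cell" using fund_parallelepiped_bounded[OF finC] by (auto simp: bounded_iff)
qed

text \<open>Countably many translates of the cell cover \<open>V\<close>, which has positive
  measure, so the cell cannot be a null set.\<close>

lemma emeasure_cell_pos: "emeasure \<mu> cell \<noteq> 0"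
proof
  assume 0: "emeasure \<mu> cell = 0"
  \<comment> \<open>Restricting the coefficient functions to the finite set \<open>C\<close> makes
    \<open>L\<close> part of the image of a countable function space.\<close>
  have "L \<subseteq> (\<lambda>c. \<Sum>b\<in>C. real_of_int (c b) *\<^sub>R b) ` (C \<rightarrow>\<^sub>E UNIV)"
  proof
    fix z assume "z \<in> L"
    then obtain c :: "real^'n \<Rightarrow> int" where c: "z = (\<Sum>b\<in>C. of_int (c b) *\<^sub>R b)"
      using basis unfolding lattice_basis_def by auto
    then have "z = (\<Sum>b\<in>C. real_of_int (restrict c C b) *\<^sub>R b)" by simp
    then show "z \<in> (\<lambda>c. \<Sum>b\<in>C. real_of_int (c b) *\<^sub>R b) ` (C \<rightarrow>\<^sub>E UNIV)"
      by (intro image_eqI[of _ _ "restrict c C"]) auto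
  qed
  moreover have "countable (C \<rightarrow>\<^sub>E (UNIV :: int set))" by (intro countable_PiE finC) auto
  ultimately have cL: "countable L" by (meson countable_image countable_subset)
  have "(\<Union>z\<in>L. {x. x - z \<in> cell}) \<in> null_sets \<mu>"
    using tile_borel emeasure_tile 0 by (intro null_sets_UN' cL null_setsI) auto
  then have "emeasure \<mu> (\<Union>z\<in>L. {x. x - z \<in> cell}) = 0" by (rule null_setsD1)
  moreover have "V \<subseteq> (\<Union>z\<in>L. {x. x - z \<in> cell})" using lattice_tiles_cover[OF basis] spanC by auto
  moreover have "(\<Union>z\<in>L. {x. x - z \<in> cell}) \<in> sets \<mu>"
    using tile_borel by (auto intro!: sets.countable_UN'[OF cL])
  ultimately have "emeasure \<mu> V = 0" by (metis emeasure_mono le_zero_eq)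
  then show False using span_lborel_span_pos[OF onb] by simp
qed

lemma measure_cell_pos: "measure \<mu> cell > 0"
  using emeasure_cell_pos emeasure_cell_finite
  by (simp add: measure_def enn2real_positive_iff less_top zero_less_iff_neq_zero)

end

context lattice_flat
begin

text \<open>Comparing the tiles at the lattice points of a dilate of the body \<open>G\<close> with slightly larger
and slightly smaller dilates squeezes the number of lattice points; the dilates are centred at a
relative interior point \<open>p\<close>, so that convexity absorbs the cells.\<close>

lemma lattice_count_bounds:
  assumes G: "convex G" "compact G" "0 \<in> G" "span G = V"
  shows "\<exists>c>0. \<forall>k::nat. real k > 2 * c \<longrightarrow>
     (real k - 2 * c) ^ dim V * measure \<mu> G
        \<le> real (card {z \<in> L. (1 / real k) *\<^sub>R z \<in> rel_interior G}) * measure \<mu> cell \<and>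
     real (card {z \<in> L. (1 / real k) *\<^sub>R z \<in> G}) * measure \<mu> cell
        \<le> (real k + c) ^ dim V * measure \<mu> G"
proof -
  have Gb: "G \<in> sets borel" using G(2) by (simp add: borel_compact)
  have GV: "G \<subseteq> V" using G(4) span_superset by blast
  have sV: "subspace V" using G(4) by auto
  have aff: "affine hull G = V" using affine_hull_span_0[of G] G(3,4) by (simp add: hull_inc)
  obtain p where "p \<in> rel_interior G" using G(1,3) rel_interior_eq_empty by blast
  then have p: "p \<in> rel_interior G" "p \<in> G" "p \<in> V" using rel_interior_subset GV by auto
  obtain e where e: "e > 0" "cball p e \<inter> V \<subseteq> G"
    using p(1) aff unfolding mem_rel_interior_cball by auto
  \<comment> \<open>Shrunk by the factor \<open>1 / c\<close>, the cell and its reflection fit into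
    the ball of radius \<open>e\<close> around 0, so they stay in \<open>G\<close> when moved to
    \<open>p\<close>. The added 1 keeps \<open>c\<close> positive even when \<open>C\<close> is
    empty.\<close>
  define c where "c = (sum norm C + 1) / e"
  have c: "c > 0" using e(1) unfolding c_def by (intro divide_pos_pos add_nonneg_pos sum_nonneg) auto
  have shift: "p + s *\<^sub>R q \<in> G" if q: "q \<in> cell" and s: "\<bar>s\<bar> = 1 / c" for q s
  proof -
    have "norm (s *\<^sub>R q) \<le> (1 / c) * sum norm C"
      using fund_parallelepiped_bounded[OF finC q] s c by (simp add: mult_left_mono divide_right_mono)
    also have "\<dots> \<le> e"
      using e(1) sum_nonneg[of C norm] by (simp add: c_def field_simps)
    finally have "p + s *\<^sub>R q \<in> cball p e" by (simp add: dist_norm)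
    moreover have "p + s *\<^sub>R q \<in> V"
      using q fund_parallelepiped_span spanC p(3) sV by (auto intro!: subspace_add subspace_scale)
    ultimately show ?thesis using e(2) by blast
  qed
  have finL: "finite {z \<in> L. (1 / real k) *\<^sub>R z \<in> S}" if "S \<subseteq> G" "k > 0" for S and k :: nat
    by (rule finite_subset[OF _ finite_dilate_points[OF bounded_subset[OF compact_imp_bounded[OF G(2)] that(1)] that(2)]])
       (use integral in auto)
  \<comment> \<open>\<open>Y k t\<close> is the dilate of \<open>G\<close> by \<open>t\<close>,
    placed so that the image of \<open>p\<close> is \<open>k p\<close>.\<close>
  define Y where "Y k t = {x. p + (1 / t) *\<^sub>R (x - k *\<^sub>R p) \<in> G}" for k t :: real
  have Y_alt: "Y k t = {x. (p - (k / t) *\<^sub>R p) + (1 / t) *\<^sub>R x \<in> G}" for k t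
    unfolding Y_def by (simp add: algebra_simps)
  have Y_borel: "Y k t \<in> sets borel" for k t
    unfolding Y_alt
    using measurable_sets[of "\<lambda>x. (p - (k / t) *\<^sub>R p) + (1 / t) *\<^sub>R x" borel borel G] Gb
    by (simp add: vimage_def)
  have Y_measure: "emeasure \<mu> (Y k t) = ennreal (t ^ dim V) * emeasure \<mu> G" if t: "t > 0" for k t
  proof -
    have "p - (k / t) *\<^sub>R p \<in> span B" using onb_props(3) p(3) sV by (auto intro!: subspace_diff subspace_scale)
    then have "emeasure \<mu> G = ennreal ((1 / t) ^ dim V) * emeasure \<mu> (Y k t)"
      using span_lborel_affine[OF onb_props(1) _ _ Gb, of "1/t"] t onb_props(4) Y_alt by simp
    then have "ennreal (t ^ dim V) * emeasure \<mu> G = ennreal (t ^ dim V) * ennreal ((1 / t) ^ dim V) * emeasure \<mu> (Y k t)"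
      by (simp add: mult.assoc)
    also have "ennreal (t ^ dim V) * ennreal ((1 / t) ^ dim V) = 1"
      using t by (simp add: ennreal_mult[symmetric] power_mult_distrib[symmetric])
    finally show ?thesis by simp
  qed
  have fin_G: "emeasure \<mu> G < \<infinity>" by (rule span_lborel_bounded[OF onb compact_imp_bounded[OF G(2)] Gb])
  have eq_G: "emeasure \<mu> G = ennreal (measure \<mu> G)" using fin_G by (simp add: emeasure_eq_ennreal_measure less_top)
  have eq_cell: "emeasure \<mu> cell = ennreal (measure \<mu> cell)"
    using emeasure_cell_finite by (simp add: emeasure_eq_ennreal_measure less_top)
  show ?thesis
  proof (intro exI[of _ c] conjI allI impI c)
    fix k :: nat assume k: "2 * c < real k"
    then have k0: "k > 0" "real k > 0" using c by auto
    let ?Zi = "{z \<in> L. (1 / real k) *\<^sub>R z \<in> rel_interior G}"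
    let ?Z = "{z \<in> L. (1 / real k) *\<^sub>R z \<in> G}"
    \<comment> \<open>One of the two \<open>c\<close> absorbs the cell around \<open>x\<close>,
      through the point \<open>q\<close>. The other pulls \<open>z / k\<close> from \<open>h\<close>
      strictly towards \<open>p\<close>, which lands it in the relative interior.\<close>
    have "Y (real k) (real k - 2 * c) \<subseteq> (\<Union>z\<in>?Zi. {x. x - z \<in> cell})"
    proof
      fix x assume "x \<in> Y (real k) (real k - 2 * c)"
      define g where "g = p + (1 / (real k - 2 * c)) *\<^sub>R (x - real k *\<^sub>R p)"
      have g: "g \<in> G" using \<open>x \<in> _\<close> by (simp add: Y_def g_def)
      have "(real k - 2 * c) *\<^sub>R (g - p) = x - real k *\<^sub>R p" using k by (simp add: g_def)
      then have x: "x = real k *\<^sub>R p + (real k - 2 * c) *\<^sub>R (g - p)" by (simp add: algebra_simps)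
      have "x \<in> V" unfolding x using g GV p(3) sV by (intro subspace_add subspace_scale subspace_diff) auto
      then obtain z where z: "z \<in> L" "x - z \<in> cell" using lattice_tiles_cover[OF basis] spanC by blast
      define q where "q = p + (- 1 / c) *\<^sub>R (x - z)"
      have q: "q \<in> G" unfolding q_def using c by (intro shift z) simp
      have "c *\<^sub>R (q - p) = - (x - z)" using c by (simp add: q_def)
      then have zz: "z = real k *\<^sub>R p + (real k - 2 * c) *\<^sub>R (g - p) + c *\<^sub>R (q - p)"
        using x by (simp add: algebra_simps)
      define h where "h = ((real k - 2 * c) / (real k - c)) *\<^sub>R g + (c / (real k - c)) *\<^sub>R q"
      have h: "h \<in> G"
        unfolding h_def using g q c k by (intro convexD[OF G(1)]) (auto simp: add_divide_distrib[symmetric])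
      have kh: "(real k - c) *\<^sub>R h = (real k - 2 * c) *\<^sub>R g + c *\<^sub>R q"
        using c k by (simp add: h_def scaleR_add_right)
      have "real k *\<^sub>R (h - (c / real k) *\<^sub>R (h - p)) = (real k - c) *\<^sub>R h + c *\<^sub>R p"
        using k0 by (simp add: algebra_simps)
      also have "\<dots> = z"
      proof -
        have "real k - 2 * c = real k - c - c" by simp
        then have e: "(real k - 2 * c) *\<^sub>R v = real k *\<^sub>R v - c *\<^sub>R v - c *\<^sub>R v" for v :: "real^'n"
          by (simp only: scaleR_left_diff_distrib)
        show ?thesis unfolding kh zz e by (simp add: algebra_simps)
      qed
      finally have "(1 / real k) *\<^sub>R z = h - (c / real k) *\<^sub>R (h - p)" using k0 by auto
      moreover have "h - (c / real k) *\<^sub>R (h - p) \<in> rel_interior G"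
        using c k k0 by (intro rel_interior_convex_shrink[OF G(1) p(1) h]) auto
      ultimately show "x \<in> (\<Union>z\<in>?Zi. {x. x - z \<in> cell})" using z by auto
    qed
    then have "emeasure \<mu> (Y (real k) (real k - 2 * c)) \<le> of_nat (card ?Zi) * emeasure \<mu> cell"
      using finL[OF rel_interior_subset k0(1)] by (intro tiles_covering) auto
    then have "ennreal ((real k - 2 * c) ^ dim V * measure \<mu> G) \<le> ennreal (real (card ?Zi) * measure \<mu> cell)"
      using k by (simp add: Y_measure eq_G eq_cell ennreal_mult ennreal_of_nat_eq_real_of_nat)
    then show "(real k - 2 * c) ^ dim V * measure \<mu> G \<le> real (card ?Zi) * measure \<mu> cell"
      by (simp add: ennreal_le_iff)
    \<comment> \<open>A point \<open>x\<close> of the tile at \<open>z = k g\<close> is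
      \<open>k g + c (q - p)\<close> with \<open>q\<close> in \<open>G\<close>. Convexity merges
      \<open>g\<close> and \<open>q\<close> into one point of \<open>G\<close>, scaled by
      \<open>k + c\<close> about \<open>p\<close>.\<close>
    have "of_nat (card ?Z) * emeasure \<mu> cell \<le> emeasure \<mu> (Y (real k) (real k + c))"
    proof (rule tiles_inside[OF finL[OF subset_refl k0(1)] _ Y_borel])
      fix z x assume z: "z \<in> ?Z" "x - z \<in> cell"
      define g where "g = (1 / real k) *\<^sub>R z"
      have g: "g \<in> G" "z = real k *\<^sub>R g" using z k0 by (auto simp: g_def)
      define q where "q = p + (1 / c) *\<^sub>R (x - z)"
      have q: "q \<in> G" unfolding q_def using c by (intro shift z) simp
      have qx: "c *\<^sub>R (q - p) = x - z" using c by (simp add: q_def)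
      have "(real k / (real k + c)) *\<^sub>R g + (c / (real k + c)) *\<^sub>R q \<in> G"
        using g q c k0 by (intro convexD[OF G(1)]) (auto simp: add_divide_distrib[symmetric])
      also have "(real k / (real k + c)) *\<^sub>R g + (c / (real k + c)) *\<^sub>R q
          = (1 / (real k + c)) *\<^sub>R (real k *\<^sub>R g + c *\<^sub>R q)" by (simp add: scaleR_add_right)
      also have "real k *\<^sub>R g + c *\<^sub>R q = (x - real k *\<^sub>R p) + (real k + c) *\<^sub>R p"
        using qx g(2) by (simp add: algebra_simps)
      also have "(1 / (real k + c)) *\<^sub>R \<dots> = p + (1 / (real k + c)) *\<^sub>R (x - real k *\<^sub>R p)"
        using c k0 by (simp add: scaleR_add_right)
      finally show "x \<in> Y (real k) (real k + c)" by (simp add: Y_def)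
    qed auto
    then have "ennreal (real (card ?Z) * measure \<mu> cell) \<le> ennreal ((real k + c) ^ dim V * measure \<mu> G)"
      using c k0 by (simp add: Y_measure eq_G eq_cell ennreal_mult ennreal_of_nat_eq_real_of_nat)
    then show "real (card ?Z) * measure \<mu> cell \<le> (real k + c) ^ dim V * measure \<mu> G"
      using c by (simp add: ennreal_le_iff)
  qed
qed

text \<open>The relative interior contains at most as many lattice points as the body, so the lower
  bound for the one and the upper bound for the other enclose both counts.\<close>

lemma lattice_count_limit:
  assumes G: "convex G" "compact G" "0 \<in> G" "span G = V"
  shows "(\<lambda>k. real (card {z \<in> L. (1 / real k) *\<^sub>R z \<in> rel_interior G}) / real k ^ dim V)
      \<longlonglongrightarrow> measure \<mu> G / measure \<mu> cell"
    and "(\<lambda>k. real (card {z \<in> L. (1 / real k) *\<^sub>R z \<in> G}) / real k ^ dim V)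
      \<longlonglongrightarrow> measure \<mu> G / measure \<mu> cell"
proof -
  let ?Ni = "\<lambda>k::nat. real (card {z \<in> L. (1 / real k) *\<^sub>R z \<in> rel_interior G})"
  let ?N = "\<lambda>k::nat. real (card {z \<in> L. (1 / real k) *\<^sub>R z \<in> G})"
  let ?q = "measure \<mu> G / measure \<mu> cell"
  obtain c where c: "c > 0"
    and bnd: "\<And>k::nat. real k > 2 * c \<Longrightarrow> (real k - 2 * c) ^ dim V * measure \<mu> G \<le> ?Ni k * measure \<mu> cell"
      "\<And>k::nat. real k > 2 * c \<Longrightarrow> ?N k * measure \<mu> cell \<le> (real k + c) ^ dim V * measure \<mu> G"
    using lattice_count_bounds[OF G] by blast
  have pw: "(\<lambda>k. ((real k + a) / real k) ^ dim V * ?q) \<longlonglongrightarrow> ?q" for a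
  proof -
    have "(\<lambda>k. 1 + a / real k) \<longlonglongrightarrow> 1 + 0" by (intro tendsto_add tendsto_const lim_const_over_n)
    moreover have "\<forall>\<^sub>F k in sequentially. 1 + a / real k = (real k + a) / real k"
      using eventually_gt_at_top[of 0] by eventually_elim (simp add: field_simps)
    ultimately have "(\<lambda>k. (real k + a) / real k) \<longlonglongrightarrow> 1 + 0" by (rule Lim_transform_eventually)
    then have "(\<lambda>k. ((real k + a) / real k) ^ dim V * ?q) \<longlonglongrightarrow> (1 + 0) ^ dim V * ?q"
      by (intro tendsto_intros)
    then show ?thesis by simp
  qed
  have ev: "\<forall>\<^sub>F k in sequentially. real k > 2 * c \<and> k > 0"
    using eventually_conj[OF eventually_gt_at_top[of "nat \<lceil>2 * c\<rceil>"] eventually_gt_at_top[of 0]]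
    by eventually_elim linarith
  have le: "?Ni k \<le> ?N k" if "k > 0" for k
  proof -
    have "finite {z \<in> L. (1 / real k) *\<^sub>R z \<in> G}"
      by (rule finite_subset[OF _ finite_dilate_points[OF compact_imp_bounded[OF G(2)] that]])
         (use integral in auto)
    then show ?thesis using rel_interior_subset[of G] by (intro of_nat_mono card_mono) auto
  qed
  have lo: "\<forall>\<^sub>F k in sequentially. ((real k + (- (2 * c))) / real k) ^ dim V * ?q \<le> ?Ni k / real k ^ dim V"
    using ev
  proof eventually_elim
    case (elim k)
    then have "((real k - 2 * c) ^ dim V * measure \<mu> G) / measure \<mu> cell \<le> ?Ni k"
      using bnd(1)[of k] measure_cell_pos by (simp add: divide_le_eq)
    then have "((real k - 2 * c) ^ dim V * measure \<mu> G) / measure \<mu> cell / real k ^ dim V \<le> ?Ni k / real k ^ dim V"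
      by (intro divide_right_mono) auto
    then show ?case by (simp add: power_divide field_simps)
  qed
  have hi: "\<forall>\<^sub>F k in sequentially. ?N k / real k ^ dim V \<le> ((real k + c) / real k) ^ dim V * ?q"
    using ev
  proof eventually_elim
    case (elim k)
    then have "?N k \<le> ((real k + c) ^ dim V * measure \<mu> G) / measure \<mu> cell"
      using bnd(2)[of k] measure_cell_pos by (simp add: le_divide_eq)
    then have "?N k / real k ^ dim V \<le> ((real k + c) ^ dim V * measure \<mu> G) / measure \<mu> cell / real k ^ dim V"
      by (intro divide_right_mono) auto
    then show ?case by (simp add: power_divide field_simps)
  qed
  have mid: "\<forall>\<^sub>F k in sequentially. ?Ni k / real k ^ dim V \<le> ?N k / real k ^ dim V"
    using ev by eventually_elim (auto intro: divide_right_mono le)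
  have lo': "\<forall>\<^sub>F k in sequentially. ((real k + (- (2 * c))) / real k) ^ dim V * ?q \<le> ?N k / real k ^ dim V"
    using lo mid by eventually_elim (rule order_trans)
  have hi': "\<forall>\<^sub>F k in sequentially. ?Ni k / real k ^ dim V \<le> ((real k + c) / real k) ^ dim V * ?q"
    using mid hi by eventually_elim (rule order_trans)
  show "(\<lambda>k. ?Ni k / real k ^ dim V) \<longlonglongrightarrow> ?q"
    by (rule tendsto_sandwich[OF lo hi' pw pw])
  show "(\<lambda>k. ?N k / real k ^ dim V) \<longlonglongrightarrow> ?q"
    by (rule tendsto_sandwich[OF lo' hi pw pw])
qed

end

section \<open>Existence of bases for integral lattices\<close>

lemma basis_in_integer_span:
  fixes C :: "'a::real_vector set"
  assumes "finite C" "b \<in> C"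
  shows "b \<in> range (\<lambda>c::'a \<Rightarrow> int. \<Sum>x\<in>C. of_int (c x) *\<^sub>R x)"
proof (rule range_eqI[where x = "\<lambda>x. if x = b then 1 else 0"])
  show "b = (\<Sum>x\<in>C. of_int (if x = b then 1 else 0) *\<^sub>R x)" using assms
    by (simp add: if_distrib[of "\<lambda>t. of_int t *\<^sub>R _"] cong: if_cong)
qed

lemma lattice_basis_subset:
  assumes "lattice_basis C L"
  shows "C \<subseteq> L"
  using assms basis_in_integer_span[of C] unfolding lattice_basis_def by (auto dest: finiteI_independent)

lemma integral_lattice_basis_aux:
  fixes L :: "(real^'n) set"
  assumes L: "L \<subseteq> int_points" "0 \<in> L" "\<And>x y. x \<in> L \<Longrightarrow> y \<in> L \<Longrightarrow> x - y \<in> L" and "finite I"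
  shows "\<exists>C. lattice_basis C {x \<in> L. \<forall>i. i \<notin> I \<longrightarrow> vec_nth x i = 0}"
  using \<open>finite I\<close>
proof (induction I)
  case empty
  have "{x \<in> L. \<forall>i. i \<notin> {} \<longrightarrow> vec_nth x i = 0} = {0}"
    using L(2) by (auto simp: Finite_Cartesian_Product.vec_eq_iff)
  then show ?case unfolding lattice_basis_def by (intro exI[of _ "{}"]) (simp add: independent_empty)
next
  case (insert i I)
  let ?L = "\<lambda>I. {x \<in> L. \<forall>i. i \<notin> I \<longrightarrow> vec_nth x i = 0}"
  obtain C where C: "independent C" "?L I = range (\<lambda>c::(real^'n) \<Rightarrow> int. \<Sum>b\<in>C. of_int (c b) *\<^sub>R b)"
    using insert.IH unfolding lattice_basis_def by blast
  have finC: "finite C" using C(1) by (simp add: finiteI_independent)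
  show ?case
  proof (cases "\<forall>x\<in>?L (insert i I). vec_nth x i = 0")
    case True
    then have "?L (insert i I) = ?L I" by auto
    then show ?thesis using insert.IH by simp
  next
    case False
    have neg: "- x \<in> L" if "x \<in> L" for x using L(3)[OF L(2) that] by simp
    have add: "x + y \<in> L" if "x \<in> L" "y \<in> L" for x y using L(3)[OF that(1) neg[OF that(2)]] by simp
    have mult: "real m *\<^sub>R x \<in> L" if "x \<in> L" for x and m :: nat
      by (induction m) (use that add L(2) in \<open>auto simp: scaleR_left_distrib\<close>)
    have imult: "real_of_int m *\<^sub>R x \<in> L" if "x \<in> L" for x m
    proof (cases "m \<ge> 0")
      case True then show ?thesis using mult[OF that, of "nat m"] by simp
    next
      case False then show ?thesis using neg[OF mult[OF that, of "nat (- m)"]] by simp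
    qed
    define co where "co x = \<lfloor>vec_nth x i\<rfloor>" for x :: "real^'n"
    have co: "vec_nth x i = of_int (co x)" if "x \<in> L" for x
      using that L(1) by (auto simp: co_def int_points_def)
    define good where "good n \<longleftrightarrow> n > 0 \<and> (\<exists>x\<in>?L (insert i I). nat \<bar>co x\<bar> = n)" for n
    obtain x0 where x0: "x0 \<in> ?L (insert i I)" "vec_nth x0 i \<noteq> 0" using False by blast
    then have "good (nat \<bar>co x0\<bar>)" unfolding good_def using co[of x0] by auto
    then have gL: "good (LEAST n. good n)" by (rule LeastI)
    then obtain w where w: "w \<in> ?L (insert i I)" "nat \<bar>co w\<bar> = (LEAST n. good n)" "co w \<noteq> 0"
      unfolding good_def by auto
    have min: "nat \<bar>co w\<bar> \<le> nat \<bar>co x\<bar>" if "x \<in> ?L (insert i I)" "co x \<noteq> 0" for x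
      unfolding w(2) using that by (intro Least_le) (auto simp: good_def)
    have CI: "b \<in> ?L I" if b: "b \<in> C" for b
      using basis_in_integer_span[OF finC b] C(2) by blast
    have wC: "w \<notin> span C"
    proof
      assume "w \<in> span C"
      moreover have "subspace {x :: real^'n. vec_nth x i = 0}" by (auto simp: subspace_def)
      moreover have "C \<subseteq> {x. vec_nth x i = 0}" using CI insert.hyps by auto
      ultimately have "vec_nth w i = 0" using span_minimal by blast
      then show False using w co by auto
    qed
    have wnC: "w \<notin> C" using wC span_base by blast
    have ind: "independent (insert w C)" using C(1) wC by (simp add: independent_insert)
    have "?L (insert i I) = range (\<lambda>c::(real^'n) \<Rightarrow> int. \<Sum>b\<in>insert w C. of_int (c b) *\<^sub>R b)" (is "?A = ?R")
    proof
      show "?R \<subseteq> ?A"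
      proof
        fix x assume "x \<in> ?R"
        then obtain c :: "real^'n \<Rightarrow> int" where c: "x = (\<Sum>b\<in>insert w C. of_int (c b) *\<^sub>R b)" by auto
        have s: "x = of_int (c w) *\<^sub>R w + (\<Sum>b\<in>C. of_int (c b) *\<^sub>R b)"
          unfolding c using finC wnC by simp
        have m: "(\<Sum>b\<in>C. of_int (c b) *\<^sub>R b) \<in> ?L I" unfolding C(2) by blast
        have "x \<in> L" unfolding s using m w(1) by (auto intro: add imult)
        moreover have "vec_nth x j = 0" if "j \<notin> insert i I" for j
          unfolding s vector_add_component vector_scaleR_component using m w(1) that by simp
        ultimately show "x \<in> ?A" by simp
      qed
      show "?A \<subseteq> ?R"
      proof
        fix x assume x: "x \<in> ?A"
        \<comment> \<open>Subtracting \<open>q\<close> times \<open>w\<close> leaves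
          \<open>co x mod co w\<close> as \<open>i\<close>-th coordinate, and minimality of
          \<open>w\<close> makes it 0.\<close>
        define q where "q = co x div co w"
        define y where "y = x - real_of_int q *\<^sub>R w"
        have yA: "y \<in> ?A" unfolding y_def using x w(1) by (auto intro: L(3) imult)
        have "vec_nth y i = of_int (co x - q * co w)" using co[of x] co[of w] x w(1) by (simp add: y_def)
        then have coy: "co y = co x mod co w" unfolding co_def[of y] q_def by (simp add: minus_div_mult_eq_mod)
        have "co y = 0"
        proof (rule ccontr)
          assume "co y \<noteq> 0"
          then have "nat \<bar>co w\<bar> \<le> nat \<bar>co x mod co w\<bar>" using min[OF yA] coy by simp
          moreover have "\<bar>co x mod co w\<bar> < \<bar>co w\<bar>" using w(3) by (rule abs_mod_less)
          ultimately show False by linarith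
        qed
        then have "vec_nth y i = 0" using co[of y] yA by simp
        then have "y \<in> ?L I" using yA by auto
        then obtain c :: "real^'n \<Rightarrow> int" where c: "y = (\<Sum>b\<in>C. of_int (c b) *\<^sub>R b)" using C(2) by auto
        have "(\<Sum>b\<in>C. real_of_int ((c(w := q)) b) *\<^sub>R b) = y" unfolding c using wnC by (intro sum.cong) auto
        then have xe: "(\<Sum>b\<in>insert w C. real_of_int ((c(w := q)) b) *\<^sub>R b) = x"
          using finC wnC by (simp add: y_def)
        show "x \<in> ?R" by (rule range_eqI[where x = "c(w := q)"]) (simp only: xe)
      qed
    qed
    then show ?thesis unfolding lattice_basis_def using ind by blast
  qed
qed

lemma integral_lattice_basis:
  fixes L :: "(real^'n) set"
  assumes "L \<subseteq> int_points" "0 \<in> L" "\<And>x y. x \<in> L \<Longrightarrow> y \<in> L \<Longrightarrow> x - y \<in> L"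
  shows "\<exists>C. lattice_basis C L"
  using integral_lattice_basis_aux[OF assms, of UNIV] by simp

section \<open>Ehrhart polynomial and reciprocity\<close>

text \<open>Moving \<open>x\<close> slightly towards (\<open>s = 1\<close>) or away from (\<open>s = -1\<close>) a generic interior point \<open>q\<close>
leaves every exceptional flat. Whether the moved point lies in a simplex is decided by a half-open
version of that simplex, and the two directions remove complementary sets of facets.\<close>

lemma eventually_line_avoids_affine:
  fixes K :: "'a::real_vector set"
  assumes "affine K" "q \<notin> K" "s \<noteq> 0"
  shows "\<forall>\<^sub>F \<epsilon> in at_right (0::real). x + (s * \<epsilon>) *\<^sub>R (q - x) \<notin> K"
proof (cases "\<exists>\<epsilon>>0. x + (s * \<epsilon>) *\<^sub>R (q - x) \<in> K")
  case False
  then show ?thesis by (auto simp: eventually_at_right_field intro!: exI[of _ 1])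
next
  case True
  then obtain e where e: "e > 0" "x + (s * e) *\<^sub>R (q - x) \<in> K" by blast
  have "x + (s * y) *\<^sub>R (q - x) \<notin> K" if y: "0 < y" "y < e" for y
  proof
    assume yK: "x + (s * y) *\<^sub>R (q - x) \<in> K"
    \<comment> \<open>Two points of the line in \<open>K\<close> force the whole line into
      \<open>K\<close>; \<open>t\<close> is the affine weight that reaches parameter 1, that is
      \<open>q\<close>.\<close>
    define t where "t = (1 - s * e) / (s * y - s * e)"
    have "s * y - s * e \<noteq> 0" using assms(3) y by simp
    then have t: "s * e + t * (s * y - s * e) = 1" by (simp add: t_def)
    have "(1 - t) *\<^sub>R (x + (s * e) *\<^sub>R (q - x)) + t *\<^sub>R (x + (s * y) *\<^sub>R (q - x)) \<in> K"
      by (rule mem_affine[OF assms(1) e(2) yK]) simp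
    also have "(1 - t) *\<^sub>R (x + (s * e) *\<^sub>R (q - x)) + t *\<^sub>R (x + (s * y) *\<^sub>R (q - x))
        = x + (s * e + t * (s * y - s * e)) *\<^sub>R (q - x)"
      by (simp add: algebra_simps)
    also have "\<dots> = q" unfolding t by simp
    finally show False using assms(2) by simp
  qed
  then show ?thesis using e(1) unfolding eventually_at_right_field by blast
qed

text \<open>For nonzero \<open>l\<close> continuity decides. At \<open>l = 0\<close> the expression
  is \<open>s * \<epsilon> * m\<close>, whose sign is that of \<open>s * m\<close>.\<close>

lemma eventually_affine_nonneg:
  fixes l m :: real
  assumes "m \<noteq> 0"
  shows "\<forall>\<^sub>F \<epsilon> in at_right 0. 0 \<le> l + s * \<epsilon> * (m - l) \<longleftrightarrow> 0 \<le> l \<and> (s * m < 0 \<longrightarrow> 0 < l)"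
proof -
  have lim: "((\<lambda>\<epsilon>. l + s * \<epsilon> * (m - l)) \<longlongrightarrow> l) (at_right 0)"
    by (auto intro!: tendsto_eq_intros)
  consider "l > 0" | "l < 0" | "l = 0" by linarith
  then show ?thesis
  proof cases
    case 1
    then have "\<forall>\<^sub>F \<epsilon> in at_right 0. 0 < l + s * \<epsilon> * (m - l)" using order_tendstoD(1)[OF lim] by blast
    then show ?thesis by eventually_elim (use 1 in auto)
  next
    case 2
    then have "\<forall>\<^sub>F \<epsilon> in at_right 0. l + s * \<epsilon> * (m - l) < 0" using order_tendstoD(2)[OF lim] by blast
    then show ?thesis by eventually_elim (use 2 in auto)
  next
    case 3
    have "0 \<le> s * e * m \<longleftrightarrow> \<not> s * m < 0" if "e > 0" for e
    proof -
      have "s * e * m = e * (s * m)" by simp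
      then show ?thesis using that by (metis mult_less_0_iff not_le not_less_iff_gr_or_eq zero_le_mult_iff)
    qed
    then have "\<forall>\<^sub>F \<epsilon> in at_right 0. 0 \<le> s * \<epsilon> * m \<longleftrightarrow> \<not> s * m < 0"
      by (auto simp: eventually_at_right_field intro!: exI[of _ 1])
    then show ?thesis by eventually_elim (use 3 in auto)
  qed
qed

text \<open>The move is affine in barycentric coordinates, taking \<open>l w\<close> to
  \<open>l w + s * \<epsilon> * (\<beta> w - l w)\<close>. So a point on the facet opposite to
  \<open>w\<close> leaves the simplex exactly when \<open>s * \<beta> w\<close> is negative, and
  these facets are the removed ones.\<close>

lemma eventually_half_open_simplex:
  fixes W :: "(real^'n) set"
  assumes W: "finite W" "\<not> affine_dependent W" "affine hull W = UNIV"
    and q: "q = (\<Sum>w\<in>W. \<beta> w *\<^sub>R w)" "sum \<beta> W = 1" "\<And>w. w \<in> W \<Longrightarrow> \<beta> w \<noteq> 0"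
  shows "\<forall>\<^sub>F \<epsilon> in at_right 0. x + (s * \<epsilon>) *\<^sub>R (q - x) \<in> convex hull W \<longleftrightarrow>
    x \<in> half_open_simplex W {w \<in> W. s * \<beta> w < 0}"
proof -
  have "x \<in> affine hull W" using W(3) by simp
  then obtain l where l: "sum l W = 1" "x = (\<Sum>w\<in>W. l w *\<^sub>R w)"
    unfolding affine_hull_finite[OF W(1)] by auto
  have ho: "x \<in> half_open_simplex W I \<longleftrightarrow> (\<forall>w\<in>W. 0 \<le> l w \<and> (w \<in> I \<longrightarrow> 0 < l w))" for I
  proof
    assume "x \<in> half_open_simplex W I"
    then obtain l' where l': "x = (\<Sum>w\<in>W. l' w *\<^sub>R w)" "sum l' W = 1"
      "\<And>w. w \<in> W \<Longrightarrow> 0 \<le> l' w \<and> (w \<in> I \<longrightarrow> 0 < l' w)" unfolding half_open_simplex_def by blast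
    have "l w = l' w" if "w \<in> W" for w
      using affine_coords_unique[OF W(1,2), of l l' w] l l' that by simp
    then show "\<forall>w\<in>W. 0 \<le> l w \<and> (w \<in> I \<longrightarrow> 0 < l w)" using l'(3) by simp
  qed (use l in \<open>auto simp: half_open_simplex_def\<close>)
  have conv: "x + (s * \<epsilon>) *\<^sub>R (q - x) \<in> convex hull W \<longleftrightarrow> (\<forall>w\<in>W. 0 \<le> l w + s * \<epsilon> * (\<beta> w - l w))" for \<epsilon>
  proof -
    let ?m = "\<lambda>w. l w + s * \<epsilon> * (\<beta> w - l w)"
    have m: "sum ?m W = 1" "(\<Sum>w\<in>W. ?m w *\<^sub>R w) = x + (s * \<epsilon>) *\<^sub>R (q - x)"
      using l q by (simp_all add: sum.distrib sum_subtractf scaleR_left_distrib scaleR_left_diff_distrib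
        scaleR_sum_right scaleR_right_diff_distrib right_diff_distrib flip: sum_distrib_left)
    show ?thesis
    proof
      assume "x + (s * \<epsilon>) *\<^sub>R (q - x) \<in> convex hull W"
      then obtain m' where m': "\<And>w. w \<in> W \<Longrightarrow> 0 \<le> m' w" "sum m' W = 1" "(\<Sum>w\<in>W. m' w *\<^sub>R w) = x + (s * \<epsilon>) *\<^sub>R (q - x)"
        unfolding convex_hull_finite[OF W(1)] by auto
      have "?m w = m' w" if "w \<in> W" for w
        using affine_coords_unique[OF W(1,2), of ?m m' w] m m' that by simp
      then show "\<forall>w\<in>W. 0 \<le> ?m w" using m'(1) by simp
    next
      assume "\<forall>w\<in>W. 0 \<le> ?m w"
      then show "x + (s * \<epsilon>) *\<^sub>R (q - x) \<in> convex hull W"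
        unfolding convex_hull_finite[OF W(1)] using m by (intro CollectI exI[of _ ?m]) simp
    qed
  qed
  have "\<forall>\<^sub>F \<epsilon> in at_right 0. \<forall>w\<in>W. 0 \<le> l w + s * \<epsilon> * (\<beta> w - l w) \<longleftrightarrow>
      0 \<le> l w \<and> (s * \<beta> w < 0 \<longrightarrow> 0 < l w)"
    using W(1) eventually_affine_nonneg[OF q(3), of _ _ s] by (intro eventually_ball_finite) auto
  then show ?thesis
    by eventually_elim (auto simp: conv ho)
qed

text \<open>Towards \<open>q\<close>, convexity keeps the points of \<open>P\<close> and closedness
  keeps the others outside. Away from \<open>q\<close>, a moved point that is still in
  \<open>P\<close> would have \<open>x\<close> strictly between itself and \<open>q\<close>, so
  \<open>x\<close> would be interior. The factors 1 and -1 are written out to match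
  \<open>s * \<epsilon>\<close>.\<close>

lemma eventually_towards_interior:
  fixes P :: "'a::euclidean_space set"
  assumes "convex P" "closed P" "q \<in> interior P"
  shows "\<forall>\<^sub>F \<epsilon> in at_right (0::real). x + (1 * \<epsilon>) *\<^sub>R (q - x) \<in> P \<longleftrightarrow> x \<in> P"
    and "\<forall>\<^sub>F \<epsilon> in at_right (0::real). x + ((-1) * \<epsilon>) *\<^sub>R (q - x) \<in> P \<longleftrightarrow> x \<in> interior P"
proof -
  have lim: "((\<lambda>\<epsilon>. x + (s * \<epsilon>) *\<^sub>R (q - x)) \<longlongrightarrow> x) (at_right 0)" for s :: real
    by (auto intro!: tendsto_eq_intros)
  show "\<forall>\<^sub>F \<epsilon> in at_right (0::real). x + (1 * \<epsilon>) *\<^sub>R (q - x) \<in> P \<longleftrightarrow> x \<in> P"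
  proof (cases "x \<in> P")
    case True
    have "x + (1 * \<epsilon>) *\<^sub>R (q - x) \<in> P" if "0 < \<epsilon>" "\<epsilon> < 1" for \<epsilon>
    proof -
      have "(1 - \<epsilon>) *\<^sub>R x + \<epsilon> *\<^sub>R q \<in> P"
        using assms(1,3) True that interior_subset[of P] by (intro convexD) auto
      then show ?thesis by (simp add: algebra_simps)
    qed
    then show ?thesis using True unfolding eventually_at_right_field by (intro exI[of _ 1]) auto
  next
    case False
    have "\<forall>\<^sub>F \<epsilon> in at_right 0. x + (1 * \<epsilon>) *\<^sub>R (q - x) \<in> - P"
      using assms(2) False by (intro topological_tendstoD[OF lim]) auto
    then show ?thesis by eventually_elim (use False in auto)
  qed
  show "\<forall>\<^sub>F \<epsilon> in at_right (0::real). x + ((-1) * \<epsilon>) *\<^sub>R (q - x) \<in> P \<longleftrightarrow> x \<in> interior P"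
  proof (cases "x \<in> interior P")
    case True
    have "\<forall>\<^sub>F \<epsilon> in at_right 0. x + ((-1) * \<epsilon>) *\<^sub>R (q - x) \<in> interior P"
      using True by (intro topological_tendstoD[OF lim]) auto
    then show ?thesis by eventually_elim (use True interior_subset in auto)
  next
    case False
    have "x + ((-1) * \<epsilon>) *\<^sub>R (q - x) \<notin> P" if e: "0 < \<epsilon>" for \<epsilon>
    proof
      assume y: "x + ((-1) * \<epsilon>) *\<^sub>R (q - x) \<in> P"
      let ?y = "x + ((-1) * \<epsilon>) *\<^sub>R (q - x)"
      \<comment> \<open>The weight \<open>\<epsilon> / (1 + \<epsilon>)\<close> is the one that
        moves \<open>?y\<close> back to \<open>x\<close>.\<close>
      have a: "?y - (\<epsilon> / (1 + \<epsilon>)) *\<^sub>R (?y - q) \<in> interior P"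
        using e by (intro mem_interior_convex_shrink[OF assms(1,3) y]) auto
      have "?y - q = (1 + \<epsilon>) *\<^sub>R (x - q)" by (simp add: algebra_simps)
      then have "(\<epsilon> / (1 + \<epsilon>)) *\<^sub>R (?y - q) = \<epsilon> *\<^sub>R (x - q)" using e by simp
      then have b: "?y - (\<epsilon> / (1 + \<epsilon>)) *\<^sub>R (?y - q) = x" by (simp add: algebra_simps)
      show False using a False unfolding b by simp
    qed
    then show ?thesis using False unfolding eventually_at_right_field by (intro exI[of _ 1]) auto
  qed
qed

text \<open>Finitely many sets of smaller dimension form a negligible set, which cannot contain a
  nonempty open one.\<close>

lemma generic_interior_point:
  fixes P :: "'a::euclidean_space set"
  assumes "interior P \<noteq> {}" "finite \<K>" "\<And>K. K \<in> \<K> \<Longrightarrow> aff_dim K < DIM('a)"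
  shows "\<exists>q\<in>interior P. q \<notin> \<Union>\<K>"
proof (rule ccontr)
  assume "\<not> ?thesis"
  then have "interior P \<subseteq> \<Union>\<K>" by blast
  moreover have "negligible (\<Union>\<K>)"
  proof (rule negligible_Union[OF assms(2)])
    fix K assume "K \<in> \<K>"
    then obtain a b where "a \<noteq> 0" "K \<subseteq> {x. inner a x = b}"
      using aff_lowdim_subset_hyperplane[OF assms(3)] by blast
    then show "negligible K" using negligible_hyperplane negligible_subset by blast
  qed
  ultimately have "negligible (interior P)" using negligible_subset by blast
  then show False using open_not_negligible[OF open_interior assms(1)] by blast
qed

text \<open>The contribution of a box point of height \<open>h\<close> in
  \<open>card_cone_slice\<close>, as a formal polynomial.\<close>

definition shifted_binomial :: "nat \<Rightarrow> real \<Rightarrow> real poly" where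
  "shifted_binomial d h = Polynomial.smult (1 / fact d) (\<Prod>i<d. [:real d - h - real i, 1:])"

lemma poly_shifted_binomial: "poly (shifted_binomial d h) y = (y - h + real d) gchoose d"
  by (simp add: shifted_binomial_def poly_prod gbinomial_prod_rev atLeast0LessThan algebra_simps)

lemma degree_shifted_binomial: "degree (shifted_binomial d h) \<le> d"
proof -
  have "degree (\<Prod>i<d. [:real d - h - real i, 1:]) \<le> sum (degree \<circ> (\<lambda>i. [:real d - h - real i, 1:])) {..<d}"
    by (rule degree_prod_sum_le) simp
  then show ?thesis by (simp add: shifted_binomial_def)
qed

text \<open>Heights from 1 to \<open>d\<close> give a binomial coefficient with upper index in
  \<open>0..d - 1\<close>, which vanishes. Height 0 belongs to the zero vector alone, a box point
  exactly when \<open>I\<close> is empty. \<open>I \<noteq> W\<close> excludes height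
  \<open>d + 1\<close>, whose term would be \<open>(-1) ^ d\<close>.\<close>

lemma sum_box_coords_at_zero:
  fixes W :: "(real^'n) set"
  assumes W: "finite W" "card W = Suc d" "\<not> affine_dependent W" and I: "I \<subseteq> W" "I \<noteq> W"
  shows "(\<Sum>r\<in>box_coords W I. (0 - sum r W + real d) gchoose d) = (if I = {} then 1 else 0)"
proof -
  let ?t = "\<lambda>r. (0 - sum r W + real d) gchoose d"
  have Wne: "W \<noteq> {}" using W by auto
  have box: "if w \<in> I then 0 < r w \<and> r w \<le> 1 else 0 \<le> r w \<and> r w < 1" if "w \<in> W" "r \<in> box_coords W I" for r w
    using that unfolding box_coords_def by blast
  define o' where "o' = (\<lambda>w\<in>W. 0 :: real)"
  have zero: "?t r = (if r = o' then 1 else 0)" if r: "r \<in> box_coords W I" for r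
  proof (cases "sum r W = 0")
    case True
    have "0 \<le> r w" if "w \<in> W" for w using box[OF that r] by (auto split: if_splits)
    then have "r w = 0" if "w \<in> W" for w using True W(1) that by (simp add: sum_nonneg_eq_0_iff)
    then have "r = o'" using r unfolding o'_def by (intro extensionalityI[of r W]) (auto simp: box_coords_def)
    then show ?thesis using True binomial_gbinomial[of d d, where 'a = real] by simp
  next
    case False
    obtain h :: int where h: "sum r W = of_int h" using r unfolding box_coords_def by (auto elim: Ints_cases)
    have "sum r W < real (card W)" using box_coords_sum_bounds(3)[OF W(1) Wne r] I by auto
    then have "of_int h < (of_int (int d + 1) :: real)" using h W(2) by simp
    then have "h < int d + 1" by (simp only: of_int_less_iff)
    moreover have "0 \<le> h" using box_coords_sum_bounds(1)[OF W(1) Wne r] h by simp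
    moreover have "h \<noteq> 0" using False h by simp
    ultimately have "0 \<le> h" "h \<le> int d" "h \<noteq> 0" by auto
    then have "0 - sum r W + real d = real (nat (int d - h))" "nat (int d - h) < d" using h by auto
    then have "?t r = real (nat (int d - h) choose d)" "nat (int d - h) choose d = 0"
      unfolding binomial_gbinomial by simp_all
    then have "?t r = 0" by simp
    moreover have "r \<noteq> o'" using False by (auto simp: o'_def)
    ultimately show ?thesis by simp
  qed
  have "o' \<in> box_coords W I \<longleftrightarrow> I = {}"
    using I(1) by (auto simp: o'_def box_coords_def int_points_def)
  moreover have "(\<Sum>r\<in>box_coords W I. ?t r) = (\<Sum>r\<in>box_coords W I. if r = o' then 1 else 0)"
    using zero by (rule sum.cong[OF refl])
  ultimately show ?thesis using finite_box_coords[OF W(1,3), of I] by simp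
qed

text \<open>One argument with a sign \<open>s\<close> for the direction of the move treats
  \<open>P\<close> (\<open>s = 1\<close>) and its interior (\<open>s = -1\<close>) alike; only the
  removed facets differ.\<close>

lemma lattice_polytope_ehrhart:
  fixes P :: "(real^'n) set"
  assumes P: "lattice_polytope P" "aff_dim P = int CARD('n)"
  obtains f :: "real poly" where "Polynomial.degree f \<le> CARD('n)" "poly f 0 = 1"
    "\<And>k::nat. k \<ge> 1 \<Longrightarrow> real (card {z \<in> int_points. (1 / real k) *\<^sub>R z \<in> P}) = poly f (real k)"
    "\<And>k::nat. k \<ge> 1 \<Longrightarrow> real (card {z \<in> int_points. (1 / real k) *\<^sub>R z \<in> interior P}) = (-1) ^ CARD('n) * poly f (- real k)"
proof -
  define d where "d = CARD('n)"
  have poly: "polytope P" and ext: "{v. v extreme_point_of P} \<subseteq> int_points"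
    using P(1) by (auto simp: lattice_polytope_def)
  have cv: "convex P" and cl: "closed P" using poly polytope_imp_convex polytope_imp_closed by auto
  have full: "affine hull P = UNIV" using P(2) aff_dim_eq_full[of P] by simp
  have Pne: "P \<noteq> {}" using P(2) by auto
  have intne: "interior P \<noteq> {}"
    using full rel_interior_interior[of P] rel_interior_eq_empty[OF cv] Pne by simp
  obtain \<W> \<H> where tri: "finite \<W>" "finite \<H>"
     "\<forall>W\<in>\<W>. W \<subseteq> {v. v extreme_point_of P} \<and> \<not> affine_dependent W \<and> aff_dim W = aff_dim P"
     "\<forall>H\<in>\<H>. affine H \<and> aff_dim H < aff_dim P"
     "\<forall>x\<in>P - \<Union>\<H>. \<exists>!W. W \<in> \<W> \<and> x \<in> convex hull W"
    using polytope_triangulation[OF poly Pne] by (elim exE conjE) (rule that)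
  have W: "finite W" "card W = Suc d" "\<not> affine_dependent W" "W \<subseteq> int_points" "W \<subseteq> P" "affine hull W = UNIV"
    if "W \<in> \<W>" for W
  proof -
    show ind: "\<not> affine_dependent W" using tri(3) that by blast
    show fin: "finite W" using ind by (rule aff_independent_finite)
    have ad: "aff_dim W = int d" using tri(3) that P(2) by (simp add: d_def)
    show "card W = Suc d" using aff_dim_affine_independent[OF ind] ad by simp
    have We: "W \<subseteq> {v. v extreme_point_of P}" using tri(3) that by blast
    show "W \<subseteq> int_points" using We ext by blast
    show "W \<subseteq> P" using We by (auto simp: extreme_point_of_def)
    show "affine hull W = UNIV" using ad aff_dim_eq_full[of W] by (simp add: d_def)
  qed
  \<comment> \<open>Avoiding the hyperplanes of the facets of the cells keeps all barycentric
    coordinates of \<open>q\<close> nonzero. Avoiding \<open>\<H>\<close> ensures that a short move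
    along any line through \<open>q\<close> leaves the flats where cells may overlap.\<close>
  define \<K> where "\<K> = \<H> \<union> (\<Union>W\<in>\<W>. (\<lambda>w. affine hull (W - {w})) ` W)"
  have finK: "finite \<K>" using tri(1,2) W(1) by (auto simp: \<K>_def)
  have dimK: "aff_dim K < DIM(real^'n)" if KK: "K \<in> \<K>" for K
  proof (cases "K \<in> \<H>")
    case True then show ?thesis using tri(4) P(2) by simp
  next
    case False
    then obtain V w where K: "V \<in> \<W>" "w \<in> V" "K = affine hull (V - {w})" using KK by (auto simp: \<K>_def)
    have "\<not> affine_dependent (V - {w})"
      using W(3)[OF K(1)] by (rule affine_independent_subset) auto
    then have "aff_dim K = int (card (V - {w})) - 1" using K(3) by (simp add: aff_dim_affine_independent)
    then show ?thesis using W(1,2)[OF K(1)] K(2) by (simp add: d_def)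
  qed
  obtain q where q: "q \<in> interior P" "q \<notin> \<Union>\<K>"
    using generic_interior_point[OF intne finK dimK] by blast
  have "\<exists>\<beta>. q = (\<Sum>w\<in>V. \<beta> w *\<^sub>R w) \<and> sum \<beta> V = 1 \<and> (\<forall>w\<in>V. \<beta> w \<noteq> 0)" if V: "V \<in> \<W>" for V
  proof -
    have "q \<in> affine hull V" using W(6)[OF V] by simp
    then obtain \<beta> where b: "sum \<beta> V = 1" "(\<Sum>w\<in>V. \<beta> w *\<^sub>R w) = q"
      unfolding affine_hull_finite[OF W(1)[OF V]] by auto
    have "\<beta> w \<noteq> 0" if w: "w \<in> V" for w
    proof
      assume 0: "\<beta> w = 0"
      have "sum \<beta> (V - {w}) = 1" "(\<Sum>w\<in>V - {w}. \<beta> w *\<^sub>R w) = q"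
        using b 0 w W(1)[OF V] by (simp_all add: sum.remove[of V w])
      then have "q \<in> affine hull (V - {w})"
        using W(1)[OF V] by (subst affine_hull_finite) auto
      then show False using q(2) V w by (auto simp: \<K>_def)
    qed
    then show ?thesis using b by blast
  qed
  then obtain \<beta> where bary: "\<And>V. V \<in> \<W> \<Longrightarrow> q = (\<Sum>w\<in>V. \<beta> V w *\<^sub>R w) \<and> sum (\<beta> V) V = 1 \<and> (\<forall>w\<in>V. \<beta> V w \<noteq> 0)"
    by metis
  have \<beta>: "q = (\<Sum>w\<in>V. \<beta> V w *\<^sub>R w)" "sum (\<beta> V) V = 1" "\<And>w. w \<in> V \<Longrightarrow> \<beta> V w \<noteq> 0"
    if "V \<in> \<W>" for V using bary[OF that] by blast+
  \<comment> \<open>For \<open>s = 1\<close> these vertices are opposite to the facets whose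
    hyperplanes separate \<open>q\<close> from the cell, for \<open>s = -1\<close> to the remaining
    facets.\<close>
  define I where "I s V = {w \<in> V. s * \<beta> V w < 0}" for s :: real and V
  have I_sub: "I s V \<subseteq> V" for s V by (auto simp: I_def)
  have I_neg: "I (-1) V = V - I 1 V" if "V \<in> \<W>" for V
    using \<beta>(3)[OF that] by (force simp: I_def)
  have I_ne: "I 1 V \<noteq> V" if V: "V \<in> \<W>" for V
  proof
    assume "I 1 V = V"
    then have "\<forall>w\<in>V. \<beta> V w < 0" by (auto simp: I_def)
    then have "sum (\<beta> V) V \<le> 0" by (intro sum_nonpos) (auto intro: less_imp_le)
    then show False using \<beta>(2)[OF V] by simp
  qed
  have half_open_partition: "(\<forall>x. X x \<longleftrightarrow> (\<exists>V\<in>\<W>. x \<in> half_open_simplex V (I s V))) \<and>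
      (\<forall>x. \<forall>V\<in>\<W>. \<forall>V'\<in>\<W>. x \<in> half_open_simplex V (I s V) \<longrightarrow> x \<in> half_open_simplex V' (I s V') \<longrightarrow> V = V')"
    if s: "s \<noteq> 0" and X: "\<And>x. \<forall>\<^sub>F \<epsilon> in at_right (0::real). x + (s * \<epsilon>) *\<^sub>R (q - x) \<in> P \<longleftrightarrow> X x" for s X
  proof -
    \<comment> \<open>Finitely many conditions valid for all small positive
      \<open>\<epsilon>\<close> hold at a common one. The moved point \<open>y\<close> is generic,
      so its unique cell can be transferred back to \<open>x\<close>.\<close>
    have gen: "\<exists>y. y \<notin> \<Union>\<H> \<and> (y \<in> P \<longleftrightarrow> X x) \<and> (\<forall>V\<in>\<W>. y \<in> convex hull V \<longleftrightarrow> x \<in> half_open_simplex V (I s V))" for x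
    proof -
      have "\<forall>\<^sub>F \<epsilon> in at_right 0. \<forall>H\<in>\<H>. x + (s * \<epsilon>) *\<^sub>R (q - x) \<notin> H"
      proof (intro eventually_ball_finite tri(2) ballI)
        fix H assume "H \<in> \<H>"
        then have "affine H" "q \<notin> H" using tri(4) q(2) by (auto simp: \<K>_def)
        then show "\<forall>\<^sub>F \<epsilon> in at_right 0. x + (s * \<epsilon>) *\<^sub>R (q - x) \<notin> H"
          using s by (rule eventually_line_avoids_affine)
      qed
      moreover have "\<forall>\<^sub>F \<epsilon> in at_right 0. \<forall>V\<in>\<W>. x + (s * \<epsilon>) *\<^sub>R (q - x) \<in> convex hull V \<longleftrightarrow> x \<in> half_open_simplex V (I s V)"
        unfolding I_def
        using tri(1) eventually_half_open_simplex[OF W(1,3,6) \<beta>] by (intro eventually_ball_finite) auto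
      ultimately have "\<forall>\<^sub>F \<epsilon> in at_right 0. (\<forall>H\<in>\<H>. x + (s * \<epsilon>) *\<^sub>R (q - x) \<notin> H) \<and>
         (x + (s * \<epsilon>) *\<^sub>R (q - x) \<in> P \<longleftrightarrow> X x) \<and>
         (\<forall>V\<in>\<W>. x + (s * \<epsilon>) *\<^sub>R (q - x) \<in> convex hull V \<longleftrightarrow> x \<in> half_open_simplex V (I s V))"
        using X[of x] by eventually_elim blast
      then show ?thesis using eventually_happens'[OF trivial_limit_at_right_real] by blast
    qed
    have hullP: "convex hull V \<subseteq> P" if "V \<in> \<W>" for V
      using W(5)[OF that] cv by (rule hull_minimal)
    have "X x \<longleftrightarrow> (\<exists>V\<in>\<W>. x \<in> half_open_simplex V (I s V))" for x
    proof -
      obtain y where y: "y \<notin> \<Union>\<H>" "y \<in> P \<longleftrightarrow> X x" "\<forall>V\<in>\<W>. y \<in> convex hull V \<longleftrightarrow> x \<in> half_open_simplex V (I s V)"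
        using gen[of x] by blast
      show ?thesis using y tri(5) hullP by blast
    qed
    moreover have "V = V'" if V: "V \<in> \<W>" "V' \<in> \<W>" and x: "x \<in> half_open_simplex V (I s V)" "x \<in> half_open_simplex V' (I s V')" for x V V'
    proof -
      obtain y where y: "y \<notin> \<Union>\<H>" "y \<in> P \<longleftrightarrow> X x" "\<forall>V\<in>\<W>. y \<in> convex hull V \<longleftrightarrow> x \<in> half_open_simplex V (I s V)"
        using gen[of x] by blast
      then have "y \<in> convex hull V" "y \<in> convex hull V'" using V x by auto
      moreover have "y \<in> P" using hullP[OF V(1)] \<open>y \<in> convex hull V\<close> by blast
      ultimately show ?thesis using tri(5) y(1) V by blast
    qed
    ultimately show ?thesis by blast
  qed
  have count: "real (card {z \<in> int_points. X ((1 / real k) *\<^sub>R z)}) =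
      (\<Sum>V\<in>\<W>. \<Sum>r\<in>box_coords V (I s V). (real k - sum r V + real d) gchoose d)"
    if s: "s \<noteq> 0" and k: "k \<ge> 1"
      and X: "\<And>x. \<forall>\<^sub>F \<epsilon> in at_right (0::real). x + (s * \<epsilon>) *\<^sub>R (q - x) \<in> P \<longleftrightarrow> X x" for s X and k :: nat
  proof -
    note part = half_open_partition[OF s X]
    let ?Z = "\<lambda>V. {z \<in> int_points. (1 / real k) *\<^sub>R z \<in> half_open_simplex V (I s V)}"
    have "{z \<in> int_points. X ((1 / real k) *\<^sub>R z)} = (\<Union>V\<in>\<W>. ?Z V)"
      using part[THEN conjunct1] by auto
    moreover have "card (\<Union>V\<in>\<W>. ?Z V) = (\<Sum>V\<in>\<W>. card (?Z V))"
    proof (rule card_UN_disjoint[OF tri(1)])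
      show "\<forall>V\<in>\<W>. finite (?Z V)" using card_cone_slice(1)[OF W(1-4) I_sub k] by blast
      show "\<forall>V\<in>\<W>. \<forall>V'\<in>\<W>. V \<noteq> V' \<longrightarrow> ?Z V \<inter> ?Z V' = {}" using part[THEN conjunct2] by blast
    qed
    ultimately show ?thesis using card_cone_slice(2)[OF W(1-4) I_sub k] by simp
  qed
  define f where "f = (\<Sum>V\<in>\<W>. \<Sum>r\<in>box_coords V (I 1 V). shifted_binomial d (sum r V))"
  have f: "poly f y = (\<Sum>V\<in>\<W>. \<Sum>r\<in>box_coords V (I 1 V). (y - sum r V + real d) gchoose d)" for y
    by (simp add: f_def poly_sum poly_shifted_binomial)
  have deg: "Polynomial.degree f \<le> d"
    unfolding f_def using tri(1) finite_box_coords[OF W(1,3)] degree_shifted_binomial by (intro degree_sum_le) auto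
  \<comment> \<open>At 0 a half-open cell contributes 1 if it has lost no facet, that is if it
    contains \<open>q\<close>, and 0 otherwise. Being generic, \<open>q\<close> lies in exactly one
    cell.\<close>
  have f0: "poly f 0 = 1"
  proof -
    have "poly f 0 = (\<Sum>V\<in>\<W>. if I 1 V = {} then 1 else 0)"
      unfolding f using sum_box_coords_at_zero[OF W(1-3) I_sub I_ne] by (intro sum.cong) auto
    also have "\<dots> = (\<Sum>V\<in>\<W>. if q \<in> convex hull V then 1 else 0)"
    proof (intro sum.cong refl)
      fix V assume V: "V \<in> \<W>"
      have "q \<in> convex hull V \<longleftrightarrow> (\<forall>w\<in>V. 0 \<le> \<beta> V w)"
      proof
        assume "q \<in> convex hull V"
        then obtain m where m: "\<And>w. w \<in> V \<Longrightarrow> 0 \<le> m w" "sum m V = 1" "(\<Sum>w\<in>V. m w *\<^sub>R w) = q"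
          unfolding convex_hull_finite[OF W(1)[OF V]] by auto
        have "\<beta> V w = m w" if "w \<in> V" for w
          using affine_coords_unique[OF W(1,3)[OF V], of "\<beta> V" m w] \<beta>[OF V] m that by simp
        then show "\<forall>w\<in>V. 0 \<le> \<beta> V w" using m(1) by simp
      next
        assume "\<forall>w\<in>V. 0 \<le> \<beta> V w"
        then show "q \<in> convex hull V"
          unfolding convex_hull_finite[OF W(1)[OF V]] using \<beta>(1,2)[OF V] by (intro CollectI exI[of _ "\<beta> V"]) simp
      qed
      then show "(if I 1 V = {} then 1 else 0) = (if q \<in> convex hull V then 1 else (0::real))"
        by (auto simp: I_def not_less)
    qed
    also have "\<dots> = real (card {V \<in> \<W>. q \<in> convex hull V})"
      using tri(1) by (simp add: sum.If_cases Int_def)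
    also have "card {V \<in> \<W>. q \<in> convex hull V} = 1"
    proof -
      have "q \<in> P - \<Union>\<H>" using q interior_subset by (auto simp: \<K>_def)
      with tri(5) have "\<exists>!V. V \<in> \<W> \<and> q \<in> convex hull V" by (rule bspec)
      then obtain V where "V \<in> \<W>" "q \<in> convex hull V" "\<And>V'. V' \<in> \<W> \<Longrightarrow> q \<in> convex hull V' \<Longrightarrow> V' = V"
        by blast
      then have "{V \<in> \<W>. q \<in> convex hull V} = {V}" by blast
      then show ?thesis by simp
    qed
    finally show ?thesis by simp
  qed
  show thesis
  proof (rule that[of f])
    show "Polynomial.degree f \<le> CARD('n)" using deg by (simp add: d_def)
    show "poly f 0 = 1" by (rule f0)
    fix k :: nat assume k: "k \<ge> 1"
    show "real (card {z \<in> int_points. (1 / real k) *\<^sub>R z \<in> P}) = poly f (real k)"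
      unfolding f by (rule count[OF _ k, of 1 "\<lambda>x. x \<in> P"]) (use eventually_towards_interior(1)[OF cv cl q(1)] in auto)
    have "real (card {z \<in> int_points. (1 / real k) *\<^sub>R z \<in> interior P}) =
       (\<Sum>V\<in>\<W>. \<Sum>r\<in>box_coords V (I (-1) V). (real k - sum r V + real d) gchoose d)"
      by (rule count[OF _ k, of "-1" "\<lambda>x. x \<in> interior P"]) (use eventually_towards_interior(2)[OF cv cl q(1)] in auto)
    also have "\<dots> = (\<Sum>V\<in>\<W>. (-1) ^ d * (\<Sum>r\<in>box_coords V (I 1 V). (- real k - sum r V + real d) gchoose d))"
      using I_neg box_coords_reciprocity[OF W(1,2,4) I_sub] by (intro sum.cong) auto
    also have "\<dots> = (-1) ^ d * poly f (- real k)" unfolding f by (simp add: sum_distrib_left)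
    finally show "real (card {z \<in> int_points. (1 / real k) *\<^sub>R z \<in> interior P}) = (-1) ^ CARD('n) * poly f (- real k)"
      by (simp add: d_def)
  qed
qed

section \<open>Lattice points on the boundary\<close>

lemma flat_lattice_translate:
  fixes V :: "(real^'n) set"
  assumes "subspace V" "v \<in> int_points"
  shows "flat_lattice ((+) v ` V) = V \<inter> int_points"
proof
  show "flat_lattice ((+) v ` V) \<subseteq> V \<inter> int_points"
    unfolding flat_lattice_def by (auto intro: subspace_diff[OF assms(1)] dest: int_points_diff)
  show "V \<inter> int_points \<subseteq> flat_lattice ((+) v ` V)"
  proof
    fix u assume u: "u \<in> V \<inter> int_points"
    have "v + u \<in> (+) v ` V \<inter> int_points" using u assms(2) by (auto intro: int_points_add)
    moreover have "v + 0 \<in> (+) v ` V" using subspace_0[OF assms(1)] by (rule imageI)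
    then have "v \<in> (+) v ` V \<inter> int_points" using assms(2) by simp
    moreover have "u = (v + u) - v" by simp
    ultimately show "u \<in> flat_lattice ((+) v ` V)" unfolding flat_lattice_def by blast
  qed
qed

text \<open>Translation by an integral vertex \<open>v\<close> carries the face into a linear
  subspace. Its \<open>k\<close>-th dilate moves by the integral vector \<open>k v\<close>, so
  lattice points correspond. The two choices of \<open>S\<close> are the two sides of the squeeze in
  \<open>boundary_points_limit\<close>.\<close>

lemma lattice_face_count_limit:
  fixes F :: "(real^'n) set"
  assumes F: "polytope F" "F \<noteq> {}" "{v. v extreme_point_of F} \<subseteq> int_points" and m: "aff_dim F = int m"
    and S: "S = F \<or> S = rel_interior F"
  shows "(\<lambda>k. real (card {z \<in> int_points. (1 / real k) *\<^sub>R z \<in> S}) / real k ^ m)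
    \<longlonglongrightarrow> rel_volume F / lattice_det (flat_lattice (affine hull F))"
proof -
  have cv: "convex F" and cp: "compact F" using F(1) polytope_imp_convex polytope_imp_compact by auto
  obtain v where v: "v extreme_point_of F" using extreme_point_exists_convex[OF cp cv F(2)] by auto
  then have vF: "v \<in> F" and vi: "v \<in> int_points" using F(3) by (auto simp: extreme_point_of_def)
  define G where "G = (+) (- v) ` F"
  define V where "V = span G"
  define L where "L = flat_lattice (affine hull F)"
  define C where "C = (SOME C. lattice_basis C L)"
  define B where "B = (SOME B. orthonormal_basis_of B V)"
  have sV: "subspace V" by (simp add: V_def)
  have aff: "affine hull F = (+) v ` V"
    using affine_hull_span_gen[of v F] vF by (simp add: hull_inc V_def G_def)
  have L: "L = V \<inter> int_points" unfolding L_def aff by (rule flat_lattice_translate[OF sV vi])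
  have "lattice_basis C L" unfolding C_def
    by (rule someI_ex, rule integral_lattice_basis)
       (auto simp: L int_points_diff subspace_diff[OF sV] subspace_0[OF sV], simp add: int_points_def)
  note C = this
  have onb: "orthonormal_basis_of B V" unfolding B_def
    by (rule someI_ex, rule orthonormal_basis_exists[OF sV])
  have zeroG: "0 \<in> G" using vF by (auto simp: G_def)
  have spanC: "span C = V"
  proof
    show "span C \<subseteq> V" using lattice_basis_subset[OF C] L sV by (intro span_minimal) auto
    have LC: "L \<subseteq> span C" using C sum_in_span unfolding lattice_basis_def by auto
    \<comment> \<open>The lattice has full rank in \<open>V\<close>: differences of vertices are
      lattice vectors, and \<open>F\<close> is the convex hull of its vertices.\<close>
    have "F = convex hull {v. v extreme_point_of F}" by (rule Krein_Milman_Minkowski[OF cp cv])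
    also have "\<dots> \<subseteq> (+) v ` span C"
    proof (rule hull_minimal)
      show "convex ((+) v ` span C)" by (intro convex_translation subspace_imp_convex subspace_span)
      show "{v. v extreme_point_of F} \<subseteq> (+) v ` span C"
      proof safe
        fix w assume w: "w extreme_point_of F"
        then have "w \<in> F" "w \<in> int_points" using F(3) by (auto simp: extreme_point_of_def)
        then have "w - v \<in> L" unfolding L V_def G_def using vi by (auto intro!: span_base int_points_diff)
        then show "w \<in> (+) v ` span C" using LC by (intro image_eqI[of _ _ "w - v"]) auto
      qed
    qed
    finally have "G \<subseteq> span C" unfolding G_def by auto
    then show "V \<subseteq> span C" unfolding V_def by (intro span_minimal subspace_span)
  qed
  interpret lattice_flat V B C L
    using onb C spanC L by unfold_locales auto
  have Fb: "F \<in> sets borel" using cp by (simp add: borel_compact)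
  have spanF: "V = span {x - y | x y. x \<in> F \<and> y \<in> F}"
  proof
    have "G \<subseteq> {x - y | x y. x \<in> F \<and> y \<in> F}" unfolding G_def using vF by force
    then show "V \<subseteq> span {x - y | x y. x \<in> F \<and> y \<in> F}" unfolding V_def by (rule span_mono)
    show "span {x - y | x y. x \<in> F \<and> y \<in> F} \<subseteq> V"
    proof (rule span_minimal[OF _ sV], safe)
      fix x y assume "x \<in> F" "y \<in> F"
      then have "- v + x \<in> V" "- v + y \<in> V" unfolding V_def G_def by (auto intro!: span_base)
      then have "(- v + x) - (- v + y) \<in> V" by (rule subspace_diff[OF sV])
      then show "x - y \<in> V" by simp
    qed
  qed
  have "rel_volume F = measure \<mu> {x. v + x \<in> F}"
    by (rule rel_volume_span_lborel[OF Fb vF spanF B_def])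
  also have "{x. v + x \<in> F} = G" unfolding G_def by (auto intro: image_eqI[of _ _ "v + _"])
  finally have volF: "rel_volume F = measure \<mu> G" .
  have spancell: "V = span {x - y | x y. x \<in> cell \<and> y \<in> cell}"
  proof
    \<comment> \<open>The half-open cell misses the basis vector \<open>b\<close> but contains
      \<open>b / 2\<close>.\<close>
    have "b \<in> span {x - y | x y. x \<in> cell \<and> y \<in> cell}" if b: "b \<in> C" for b
    proof -
      have "(\<Sum>x\<in>C. (if x = b then 1 / 2 else 0) *\<^sub>R x) = (1 / 2 :: real) *\<^sub>R b" using finC b
        by (simp add: if_distrib[of "\<lambda>t. t *\<^sub>R _"] cong: if_cong)
      then have "(1 / 2 :: real) *\<^sub>R b \<in> cell" unfolding fund_parallelepiped_def
        by (intro CollectI exI[of _ "\<lambda>x. if x = b then 1 / 2 else 0"]) auto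
      then have "(1 / 2 :: real) *\<^sub>R b - 0 \<in> {x - y | x y. x \<in> cell \<and> y \<in> cell}"
        using zero_in_fund_parallelepiped by blast
      then have "(2 :: real) *\<^sub>R ((1 / 2 :: real) *\<^sub>R b - 0) \<in> span {x - y | x y. x \<in> cell \<and> y \<in> cell}"
        by (intro span_scale span_base)
      then show ?thesis by simp
    qed
    then show "V \<subseteq> span {x - y | x y. x \<in> cell \<and> y \<in> cell}"
      unfolding spanC[symmetric] by (intro span_minimal subspace_span) auto
    show "span {x - y | x y. x \<in> cell \<and> y \<in> cell} \<subseteq> V"
    proof (rule span_minimal[OF _ sV], safe)
      fix x y assume "x \<in> cell" "y \<in> cell"
      then have "x \<in> V" "y \<in> V" using fund_parallelepiped_span spanC by auto
      then show "x - y \<in> V" by (rule subspace_diff[OF sV])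
    qed
  qed
  have "rel_volume cell = measure \<mu> {x. 0 + x \<in> cell}"
    by (rule rel_volume_span_lborel[OF fund_parallelepiped_borel[OF indC] zero_in_fund_parallelepiped spancell B_def])
  then have det: "lattice_det L = measure \<mu> cell" unfolding lattice_det_def C_def[symmetric] by simp
  have dimV: "dim V = m"
  proof -
    have "aff_dim G = aff_dim F" unfolding G_def by (rule aff_dim_translation_eq)
    moreover have "aff_dim G = int (dim G)" using zeroG by (intro aff_dim_zero) (simp add: hull_inc)
    ultimately show ?thesis using m by (simp add: V_def dim_span)
  qed
  have cG: "convex G" "compact G"
    unfolding G_def by (rule convex_translation[OF cv], rule compact_translation[OF cp])
  have SF: "S \<subseteq> F" using S rel_interior_subset by auto
  have card_eq: "card {z \<in> int_points. (1 / real k) *\<^sub>R z \<in> S} = card {y \<in> L. (1 / real k) *\<^sub>R y \<in> (+) (- v) ` S}"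
    if k: "k > 0" for k
  proof (rule bij_betw_same_card[of "\<lambda>z. z - real k *\<^sub>R v"])
    have kv: "real k *\<^sub>R v \<in> int_points" using vi by (intro int_points_scale) auto
    have sc: "(1 / real k) *\<^sub>R (z - real k *\<^sub>R v) = - v + (1 / real k) *\<^sub>R z" for z
      using k by (simp add: scaleR_right_diff_distrib)
    have inL: "z - real k *\<^sub>R v \<in> L" if z: "z \<in> int_points" "(1 / real k) *\<^sub>R z \<in> S" for z
    proof -
      have "- v + (1 / real k) *\<^sub>R z \<in> V" unfolding V_def G_def using z SF by (auto intro!: span_base)
      then have "real k *\<^sub>R ((1 / real k) *\<^sub>R (z - real k *\<^sub>R v)) \<in> V" unfolding sc by (rule subspace_scale[OF sV])
      then show ?thesis using k z kv by (simp add: L int_points_diff)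
    qed
    show "bij_betw (\<lambda>z. z - real k *\<^sub>R v) {z \<in> int_points. (1 / real k) *\<^sub>R z \<in> S}
        {y \<in> L. (1 / real k) *\<^sub>R y \<in> (+) (- v) ` S}"
    proof (rule bij_betwI[where g = "\<lambda>y. y + real k *\<^sub>R v"])
      show "(\<lambda>z. z - real k *\<^sub>R v) \<in> {z \<in> int_points. (1 / real k) *\<^sub>R z \<in> S} \<rightarrow> {y \<in> L. (1 / real k) *\<^sub>R y \<in> (+) (- v) ` S}"
      proof
        fix z assume z: "z \<in> {z \<in> int_points. (1 / real k) *\<^sub>R z \<in> S}"
        then have "- v + (1 / real k) *\<^sub>R z \<in> (+) (- v) ` S" by (intro imageI) simp
        then have "(1 / real k) *\<^sub>R (z - real k *\<^sub>R v) \<in> (+) (- v) ` S" unfolding sc .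
        then show "z - real k *\<^sub>R v \<in> {y \<in> L. (1 / real k) *\<^sub>R y \<in> (+) (- v) ` S}" using inL z by blast
      qed
      show "(\<lambda>y. y + real k *\<^sub>R v) \<in> {y \<in> L. (1 / real k) *\<^sub>R y \<in> (+) (- v) ` S} \<rightarrow> {z \<in> int_points. (1 / real k) *\<^sub>R z \<in> S}"
      proof safe
        fix y x assume y: "y \<in> L" "x \<in> S" "(1 / real k) *\<^sub>R y = - v + x"
        show "y + real k *\<^sub>R v \<in> int_points" using y(1) L kv by (auto intro: int_points_add)
        have "(1 / real k) *\<^sub>R (y + real k *\<^sub>R v) = x" using y(3) k by (simp add: scaleR_right_distrib)
        then show "(1 / real k) *\<^sub>R (y + real k *\<^sub>R v) \<in> S" using y(2) by simp
      qed
    qed auto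
  qed
  have "(\<lambda>k. real (card {y \<in> L. (1 / real k) *\<^sub>R y \<in> (+) (- v) ` S}) / real k ^ m) \<longlonglongrightarrow> measure \<mu> G / measure \<mu> cell"
    using S lattice_count_limit[OF cG zeroG V_def[symmetric]] rel_interior_translation[of "- v" F]
    unfolding dimV G_def by auto
  moreover have "\<forall>\<^sub>F k in sequentially. real (card {y \<in> L. (1 / real k) *\<^sub>R y \<in> (+) (- v) ` S}) / real k ^ m
      = real (card {z \<in> int_points. (1 / real k) *\<^sub>R z \<in> S}) / real k ^ m"
    using eventually_gt_at_top[of 0] by eventually_elim (simp only: card_eq)
  ultimately have "(\<lambda>k. real (card {z \<in> int_points. (1 / real k) *\<^sub>R z \<in> S}) / real k ^ m) \<longlonglongrightarrow> measure \<mu> G / measure \<mu> cell"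
    by (rule Lim_transform_eventually)
  then show ?thesis unfolding volF det[symmetric] L_def .
qed

text \<open>By \<open>face_of_eq\<close> the relative interiors of distinct facets are disjoint,
  which supplies the lower bound of the squeeze; covering the boundary by closed facets supplies the
  upper one.\<close>

lemma boundary_points_limit:
  fixes P :: "(real^'n) set"
  assumes P: "lattice_polytope P" "aff_dim P = int CARD('n)"
  shows "(\<lambda>k. real (card {z \<in> int_points. (1 / real k) *\<^sub>R z \<in> frontier P}) / real k ^ (CARD('n) - 1))
    \<longlonglongrightarrow> lattice_surface P"
proof -
  let ?m = "CARD('n) - 1"
  let ?\<F> = "{F. F facet_of P}"
  let ?N = "\<lambda>S k. card {z \<in> int_points. (1 / real k) *\<^sub>R z \<in> S}"
  have poly: "polytope P" and ext: "{v. v extreme_point_of P} \<subseteq> int_points"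
    using P(1) by (auto simp: lattice_polytope_def)
  have cv: "convex P" using poly polytope_imp_convex by auto
  have Pne: "P \<noteq> {}" using P(2) by auto
  have full: "affine hull P = UNIV" using P(2) aff_dim_eq_full[of P] by simp
  have intne: "interior P \<noteq> {}"
    using full rel_interior_interior[of P] rel_interior_eq_empty[OF cv] Pne by simp
  have fr: "frontier P = \<Union>?\<F>"
    using rel_frontier_nonempty_interior[OF intne] rel_frontier_of_polyhedron[OF polytope_imp_polyhedron[OF poly]] by simp
  have fin: "finite ?\<F>" using finite_polytope_facets[OF poly] .
  have bdP: "bounded P" using poly polytope_imp_bounded by auto
  have face: "F face_of P" "F \<noteq> {}" "aff_dim F = int ?m" "F \<subseteq> P" "polytope F" "{v. v extreme_point_of F} \<subseteq> int_points"
    if "F \<in> ?\<F>" for F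
  proof -
    show f: "F face_of P" and "F \<noteq> {}" using that by (auto simp: facet_of_def)
    show "aff_dim F = int ?m" using that P(2) by (simp add: facet_of_def of_nat_diff Suc_leI)
    show "F \<subseteq> P" using f face_of_imp_subset by auto
    show "polytope F" using face_of_polytope_polytope[OF poly f] .
    show "{v. v extreme_point_of F} \<subseteq> int_points" using ext extreme_point_of_face[OF f] by auto
  qed
  have lim: "(\<lambda>k. (\<Sum>F\<in>?\<F>. real (?N (S F) k) / real k ^ ?m)) \<longlonglongrightarrow> lattice_surface P"
    if "\<And>F. S F = F \<or> S F = rel_interior F" for S
    unfolding lattice_surface_def
    using lattice_face_count_limit[OF face(5,2,6,3) that] by (intro tendsto_sum) auto
  have up: "real (?N (frontier P) k) \<le> (\<Sum>F\<in>?\<F>. real (?N F k))" for k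
  proof -
    have "{z \<in> int_points. (1 / real k) *\<^sub>R z \<in> frontier P} = (\<Union>F\<in>?\<F>. {z \<in> int_points. (1 / real k) *\<^sub>R z \<in> F})"
      unfolding fr by auto
    then have "?N (frontier P) k = card (\<Union>F\<in>?\<F>. {z \<in> int_points. (1 / real k) *\<^sub>R z \<in> F})" by (rule arg_cong)
    also have "\<dots> \<le> (\<Sum>F\<in>?\<F>. ?N F k)" by (rule card_UN_le[OF fin])
    finally show ?thesis by (simp only: of_nat_sum[symmetric] of_nat_le_iff)
  qed
  have lo: "(\<Sum>F\<in>?\<F>. real (?N (rel_interior F) k)) \<le> real (?N (frontier P) k)" if k: "k > 0" for k
  proof -
    have disj: "F = F'" if "F \<in> ?\<F>" "F' \<in> ?\<F>" "x \<in> rel_interior F" "x \<in> rel_interior F'" for F F' x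
      using face_of_eq[OF face(1)[OF that(1)] face(1)[OF that(2)]] that(3,4) by blast
    have "(\<Sum>F\<in>?\<F>. ?N (rel_interior F) k) = card (\<Union>F\<in>?\<F>. {z \<in> int_points. (1 / real k) *\<^sub>R z \<in> rel_interior F})"
    proof (rule card_UN_disjoint[symmetric, OF fin])
      show "\<forall>F\<in>?\<F>. finite {z \<in> int_points. (1 / real k) *\<^sub>R z \<in> rel_interior F}"
      proof
        fix F assume "F \<in> ?\<F>"
        then have "rel_interior F \<subseteq> P" using face(4) rel_interior_subset[of F] by blast
        then show "finite {z \<in> int_points. (1 / real k) *\<^sub>R z \<in> rel_interior F}"
          by (intro finite_dilate_points[OF bounded_subset[OF bdP] k])
      qed
      show "\<forall>F\<in>?\<F>. \<forall>F'\<in>?\<F>. F \<noteq> F' \<longrightarrow> {z \<in> int_points. (1 / real k) *\<^sub>R z \<in> rel_interior F} \<inter> {z \<in> int_points. (1 / real k) *\<^sub>R z \<in> rel_interior F'} = {}"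
        using disj by blast
    qed
    also have "\<dots> \<le> ?N (frontier P) k"
    proof (rule card_mono)
      have "frontier P \<subseteq> P" using face(4) fr by blast
      then show "finite {z \<in> int_points. (1 / real k) *\<^sub>R z \<in> frontier P}"
        using finite_dilate_points[OF bounded_subset[OF bdP] k] by blast
      show "(\<Union>F\<in>?\<F>. {z \<in> int_points. (1 / real k) *\<^sub>R z \<in> rel_interior F}) \<subseteq> {z \<in> int_points. (1 / real k) *\<^sub>R z \<in> frontier P}"
        unfolding fr using rel_interior_subset by blast
    qed
    finally show ?thesis by (simp only: of_nat_sum[symmetric] of_nat_le_iff)
  qed
  show ?thesis
  proof (rule tendsto_sandwich)
    show "(\<lambda>k. (\<Sum>F\<in>?\<F>. real (?N (rel_interior F) k) / real k ^ ?m)) \<longlonglongrightarrow> lattice_surface P"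
      by (rule lim) simp
    show "(\<lambda>k. (\<Sum>F\<in>?\<F>. real (?N F k) / real k ^ ?m)) \<longlonglongrightarrow> lattice_surface P"
      by (rule lim) simp
    show "\<forall>\<^sub>F k in sequentially. (\<Sum>F\<in>?\<F>. real (?N (rel_interior F) k) / real k ^ ?m) \<le> real (?N (frontier P) k) / real k ^ ?m"
      using eventually_gt_at_top[of 0]
    proof eventually_elim
      case (elim k)
      then show ?case using lo[OF elim] by (simp add: divide_right_mono flip: sum_divide_distrib)
    qed
    show "\<forall>\<^sub>F k in sequentially. real (?N (frontier P) k) / real k ^ ?m \<le> (\<Sum>F\<in>?\<F>. real (?N F k) / real k ^ ?m)"
      using up by (simp add: divide_right_mono flip: sum_divide_distrib)
  qed
qed

section \<open>Parity and Cramer's rule\<close>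

lemma frontier_dilate:
  fixes P :: "(real^'n) set"
  assumes "k \<ge> 1"
  shows "frontier (dilate k P) = (\<lambda>x. real k *\<^sub>R x) ` frontier P"
proof -
  have lin: "linear (\<lambda>x :: real^'n. real k *\<^sub>R x)" by (rule linear_scaleR)
  have inj: "inj (\<lambda>x :: real^'n. real k *\<^sub>R x)" using assms by (auto simp: inj_on_def)
  show ?thesis
    unfolding dilate_def frontier_def
    using closure_injective_linear_image[OF lin inj, of P] interior_injective_linear_image[OF lin inj, of P]
      image_set_diff[OF inj, of "closure P" "interior P"] by simp
qed

lemma boundary_count_dilate:
  fixes P :: "(real^'n) set"
  assumes "k \<ge> 1"
  shows "boundary_count (dilate k P) = card {z \<in> int_points. (1 / real k) *\<^sub>R z \<in> frontier P}"
proof -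
  have "z \<in> (\<lambda>x. real k *\<^sub>R x) ` S \<longleftrightarrow> (1 / real k) *\<^sub>R z \<in> S" for z and S :: "(real^'n) set"
    using assms by (auto intro: image_eqI[of _ _ "(1 / real k) *\<^sub>R z"])
  then have "frontier (dilate k P) \<inter> int_points = {z \<in> int_points. (1 / real k) *\<^sub>R z \<in> frontier P}"
    unfolding frontier_dilate[OF assms] by auto
  then show ?thesis by (simp add: boundary_count_def)
qed

text \<open>\<open>n\<close> merely bounds the degree, so the coefficient can be identified with a
  limit that is not known in advance to be nonzero.\<close>

lemma poly_leading_limit:
  fixes g :: "real poly"
  assumes "Polynomial.degree g \<le> n"
  shows "(\<lambda>k. poly g (real k) / real k ^ n) \<longlonglongrightarrow> poly.coeff g n"
proof -
  have e: "poly g x = (\<Sum>i\<le>n. poly.coeff g i * x ^ i)" for x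
    unfolding poly_altdef using assms by (intro sum.mono_neutral_left) (auto simp: coeff_eq_0)
  have t: "(\<lambda>k. poly.coeff g i * (1 / real k) ^ (n - i)) \<longlonglongrightarrow> poly.coeff g i * 0 ^ (n - i)" for i
    by (intro tendsto_intros lim_const_over_n)
  have "(\<lambda>k. \<Sum>i\<le>n. poly.coeff g i * (1 / real k) ^ (n - i)) \<longlonglongrightarrow> (\<Sum>i\<le>n. poly.coeff g i * 0 ^ (n - i))"
    by (intro tendsto_sum t)
  also have "(\<Sum>i\<le>n. poly.coeff g i * 0 ^ (n - i)) = (\<Sum>i\<le>n. if i = n then poly.coeff g n else 0)"
    by (intro sum.cong) auto
  also have "\<dots> = poly.coeff g n" by simp
  finally have "(\<lambda>k. \<Sum>i\<le>n. poly.coeff g i * (1 / real k) ^ (n - i)) \<longlonglongrightarrow> poly.coeff g n" .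
  moreover have "\<forall>\<^sub>F k in sequentially. (\<Sum>i\<le>n. poly.coeff g i * (1 / real k) ^ (n - i)) = poly g (real k) / real k ^ n"
    using eventually_gt_at_top[of 0]
  proof eventually_elim
    case (elim k)
    have "poly.coeff g i * (1 / real k) ^ (n - i) = poly.coeff g i * real k ^ i / real k ^ n" if "i \<le> n" for i
      using elim that by (simp add: power_diff power_one_over field_simps)
    then show ?case by (simp add: e sum_divide_distrib)
  qed
  ultimately show ?thesis by (rule Lim_transform_eventually)
qed

lemma boundary_count_polynomial:
  fixes P :: "(real^'n) set"
  assumes P: "lattice_polytope P" "aff_dim P = int CARD('n)"
  obtains g :: "real poly" where "Polynomial.degree g \<le> CARD('n) - 1"
    "\<And>i. even (CARD('n) + i) \<Longrightarrow> poly.coeff g i = 0"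
    "poly.coeff g 0 = (if odd CARD('n) then 2 else 0)"
    "poly.coeff g (CARD('n) - 1) = lattice_surface P"
    "\<And>k. k \<ge> 1 \<Longrightarrow> real (boundary_count (dilate k P)) = poly g (real k)"
proof -
  let ?d = "CARD('n)"
  obtain f :: "real poly" where f: "Polynomial.degree f \<le> ?d" "poly f 0 = 1"
    "\<And>k::nat. k \<ge> 1 \<Longrightarrow> real (card {z \<in> int_points. (1 / real k) *\<^sub>R z \<in> P}) = poly f (real k)"
    "\<And>k::nat. k \<ge> 1 \<Longrightarrow> real (card {z \<in> int_points. (1 / real k) *\<^sub>R z \<in> interior P}) = (-1) ^ ?d * poly f (- real k)"
    using lattice_polytope_ehrhart[OF P] by blast
  \<comment> \<open>Composition with \<open>[:0, -1:]\<close> substitutes \<open>- x\<close>. The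
    \<open>i\<close>-th coefficient of \<open>f\<close> is multiplied by
    \<open>1 - (-1) ^ (d + i)\<close>, which is 0 or 2; for \<open>i = d\<close> it is 0, so the
    degree drops, and for \<open>i = 0\<close> it doubles \<open>f(0) = 1\<close> when
    \<open>d\<close> is odd.\<close>
  define g where "g = f - Polynomial.smult ((-1) ^ ?d) (pcompose f [:0, -1:])"
  have co: "poly.coeff g i = (1 - (-1) ^ (?d + i)) * poly.coeff f i" for i
    by (simp add: g_def coeff_pcompose_linear power_add algebra_simps)
  have even0: "poly.coeff g i = 0" if "even (?d + i)" for i using that by (simp add: co)
  have deg: "Polynomial.degree g \<le> ?d - 1"
  proof (rule degree_le, intro allI impI)
    fix i assume "?d - 1 < i"
    then consider "i = ?d" | "i > ?d" by linarith
    then show "poly.coeff g i = 0"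
    proof cases
      case 1 then show ?thesis by (intro even0) simp
    next
      case 2 then show ?thesis using f(1) by (simp add: co coeff_eq_0)
    qed
  qed
  have bd: "bounded P" and cl: "closed P"
    using P(1) polytope_imp_bounded polytope_imp_closed by (auto simp: lattice_polytope_def)
  have count: "real (card {z \<in> int_points. (1 / real k) *\<^sub>R z \<in> frontier P}) = poly g (real k)" if k: "k \<ge> 1" for k
  proof -
    let ?Z = "\<lambda>S. {z \<in> int_points. (1 / real k) *\<^sub>R z \<in> S}"
    have "?Z (frontier P) = ?Z P - ?Z (interior P)" using cl by (auto simp: frontier_def)
    moreover have fin: "finite (?Z P)" using finite_dilate_points[OF bd] k by simp
    moreover have sub: "?Z (interior P) \<subseteq> ?Z P" using interior_subset by blast
    ultimately have "card (?Z (frontier P)) = card (?Z P) - card (?Z (interior P))"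
      using finite_subset[OF sub fin] by (simp add: card_Diff_subset)
    moreover have "card (?Z (interior P)) \<le> card (?Z P)" using fin sub by (rule card_mono)
    ultimately have "real (card (?Z (frontier P))) = real (card (?Z P)) - real (card (?Z (interior P)))"
      by (simp add: of_nat_diff)
    then show ?thesis using f(3,4)[OF k] by (simp add: g_def poly_pcompose)
  qed
  show thesis
  proof (rule that[of g])
    show "Polynomial.degree g \<le> ?d - 1" by (rule deg)
    show "poly.coeff g i = 0" if "even (?d + i)" for i using even0[OF that] .
    show "poly.coeff g 0 = (if odd ?d then 2 else 0)" using f(2) by (simp add: co poly_0_coeff_0)
    show "real (boundary_count (dilate k P)) = poly g (real k)" if "k \<ge> 1" for k
      using count[OF that] boundary_count_dilate[OF that] by metis
    have "\<forall>\<^sub>F k in sequentially. real (card {z \<in> int_points. (1 / real k) *\<^sub>R z \<in> frontier P}) / real k ^ (?d - 1) = poly g (real k) / real k ^ (?d - 1)"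
      using eventually_ge_at_top[of 1] by eventually_elim (simp only: count)
    then have "(\<lambda>k. poly g (real k) / real k ^ (?d - 1)) \<longlonglongrightarrow> lattice_surface P"
      by (rule Lim_transform_eventually[OF boundary_points_limit[OF P]])
    then show "poly.coeff g (?d - 1) = lattice_surface P"
      using poly_leading_limit[OF deg] LIMSEQ_unique by blast
  qed
qed

text \<open>A Vandermonde argument in the squares. Once a power of \<open>i + 1\<close> is taken out
  of row \<open>i\<close>, a kernel vector becomes a nonzero polynomial of degree less than
  \<open>t\<close> with the \<open>t\<close> distinct roots \<open>(i + 1)^2\<close>. The bound
  \<open>2 * t <= d\<close> prevents truncated subtraction in the exponents.\<close>

lemma det_dilation_matrix_nonzero:
  assumes "2 * t \<le> d"
  shows "det (dilation_matrix d t) \<noteq> 0"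
proof
  let ?D = "dilation_matrix d t"
  have D: "?D \<in> carrier_mat t t" by (simp add: dilation_matrix_def)
  assume "det ?D = 0"
  then obtain v where v: "v \<in> carrier_vec t" "v \<noteq> 0\<^sub>v t" "?D *\<^sub>v v = 0\<^sub>v t"
    using det_0_iff_vec_prod_zero_field[OF D] by blast
  define p where "p = (\<Sum>j<t. Polynomial.monom (vec_index v j) (t - 1 - j))"
  have root: "poly p ((real (Suc i))^2) = 0" if i: "i < t" for i
  proof -
    have "0 = vec_index (?D *\<^sub>v v) i" using v(3) i by simp
    also have "\<dots> = (\<Sum>j<t. real (Suc i) ^ (d + 1 - 2 * Suc j) * (vec_index v j))"
      using i v(1) by (simp add: dilation_matrix_def scalar_prod_def atLeast0LessThan)
    also have "\<dots> = (\<Sum>j<t. real (Suc i) ^ (d + 1 - 2 * t) * ((vec_index v j) * ((real (Suc i))^2) ^ (t - 1 - j)))"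
    proof (intro sum.cong refl)
      fix j assume "j \<in> {..<t}"
      then have "d + 1 - 2 * Suc j = (d + 1 - 2 * t) + 2 * (t - 1 - j)" using assms by simp
      then show "real (Suc i) ^ (d + 1 - 2 * Suc j) * (vec_index v j) = real (Suc i) ^ (d + 1 - 2 * t) * ((vec_index v j) * ((real (Suc i))^2) ^ (t - 1 - j))"
        by (simp add: power_add power_mult del: of_nat_Suc)
    qed
    also have "\<dots> = real (Suc i) ^ (d + 1 - 2 * t) * poly p ((real (Suc i))^2)"
      by (simp add: p_def poly_sum poly_monom sum_distrib_left del: of_nat_Suc)
    finally show ?thesis by (simp del: of_nat_Suc)
  qed
  have co: "poly.coeff p (t - 1 - j) = vec_index v j" if j: "j < t" for j
  proof -
    have "poly.coeff p (t - 1 - j) = (\<Sum>i<t. if i = j then vec_index v j else 0)"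
      unfolding p_def coeff_sum using j by (intro sum.cong) auto
    then show ?thesis using j by simp
  qed
  obtain j where j: "j < t" "vec_index v j \<noteq> 0" using v(1,2) by (metis carrier_vecD eq_vecI index_zero_vec)
  then have p0: "p \<noteq> 0" using co[OF j(1)] by auto
  have "Polynomial.degree p < t"
    unfolding p_def using j(1) by (intro degree_sum_less) (auto intro: le_less_trans[OF degree_monom_le])
  moreover have "t \<le> card {x. poly p x = 0}"
  proof -
    have "inj_on (\<lambda>i. (real (Suc i))^2) {..<t}" by (auto simp: inj_on_def power2_eq_iff_nonneg simp del: of_nat_Suc)
    then have "t = card ((\<lambda>i. (real (Suc i))^2) ` {..<t})" by (simp add: card_image)
    also have "\<dots> \<le> card {x. poly p x = 0}" using root by (intro card_mono poly_roots_finite p0) auto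
    finally show ?thesis .
  qed
  ultimately show False using card_poly_roots_bound[OF p0] by linarith
qed

text \<open>The values at \<open>1, ..., t\<close> form a linear system for the nonconstant
  coefficients permitted by parity, and the first unknown is the leading one. The bounds on
  \<open>d\<close> say that \<open>t\<close> exponents exhaust these. Subtracting the constant term
  treats both parities at once, since it is 0 for even \<open>d\<close>.\<close>

lemma cramer_leading_coeff:
  fixes g :: "real poly"
  assumes t: "0 < t" "2 * t \<le> d" "d \<le> 2 * t + 1" and deg: "Polynomial.degree g \<le> d - 1"
    and par: "\<And>i. even (d + i) \<Longrightarrow> poly.coeff g i = 0"
    and y: "\<And>i. i < t \<Longrightarrow> y i = poly g (real (Suc i)) - poly.coeff g 0"
  shows "poly.coeff g (d - 1) = det (replace_col (dilation_matrix d t) (vec t y) 0) / det (dilation_matrix d t)"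
proof -
  let ?D = "dilation_matrix d t"
  have D: "?D \<in> carrier_mat t t" by (simp add: dilation_matrix_def)
  define x where "x = vec t (\<lambda>j. poly.coeff g (d + 1 - 2 * Suc j))"
  have x: "x \<in> carrier_vec t" by (simp add: x_def)
  have expand: "poly g z - poly.coeff g 0 = (\<Sum>j<t. z ^ (d + 1 - 2 * Suc j) * poly.coeff g (d + 1 - 2 * Suc j))" for z
  proof -
    let ?e = "\<lambda>j. d + 1 - 2 * Suc j"
    have "poly g z = (\<Sum>i\<le>d - 1. poly.coeff g i * z ^ i)"
      unfolding poly_altdef using deg by (intro sum.mono_neutral_left) (auto simp: coeff_eq_0)
    \<comment> \<open>The exponents \<open>?e j\<close> end at 1 or 2, so 0 is listed separately for
      the constant term.\<close>
    also have "\<dots> = (\<Sum>i\<in>insert 0 (?e ` {..<t}). poly.coeff g i * z ^ i)"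
    proof (rule sum.mono_neutral_right)
      show "insert 0 (?e ` {..<t}) \<subseteq> {..d - 1}" by auto
      show "\<forall>i\<in>{..d - 1} - insert 0 (?e ` {..<t}). poly.coeff g i * z ^ i = 0"
      proof
        fix i assume i: "i \<in> {..d - 1} - insert 0 (?e ` {..<t})"
        have "even (d + i)"
        proof (rule ccontr)
          assume "odd (d + i)"
          then have "even (d - 1 - i)" using i by auto
          \<comment> \<open>The column of exponent \<open>i\<close> is
            \<open>j = (d - 1 - i) / 2\<close>. It is smaller than \<open>t\<close> because
            \<open>i\<close> is not 0 and \<open>d <= 2 * t + 1\<close>.\<close>
          then obtain j where j: "d - 1 - i = 2 * j" by (rule evenE)
          have "i = ?e j" "j < t" using i j t by auto
          then show False using i by blast
        qed
        then show "poly.coeff g i * z ^ i = 0" using par by simp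
      qed
    qed simp
    also have "\<dots> = poly.coeff g 0 + (\<Sum>i\<in>?e ` {..<t}. poly.coeff g i * z ^ i)"
      using t by (subst sum.insert) auto
    also have "(\<Sum>i\<in>?e ` {..<t}. poly.coeff g i * z ^ i) = (\<Sum>j<t. poly.coeff g (?e j) * z ^ ?e j)"
      using t by (subst sum.reindex) (auto simp: inj_on_def)
    finally show ?thesis by (simp add: mult.commute)
  qed
  have "?D *\<^sub>v x = vec t y"
  proof (rule eq_vecI)
    fix i assume "i < dim_vec (vec t y)"
    then have i: "i < t" by simp
    have "vec_index (?D *\<^sub>v x) i = (\<Sum>j<t. real (Suc i) ^ (d + 1 - 2 * Suc j) * poly.coeff g (d + 1 - 2 * Suc j))"
      using i by (simp add: dilation_matrix_def x_def scalar_prod_def atLeast0LessThan)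
    then show "vec_index (?D *\<^sub>v x) i = vec_index (vec t y) i" using expand[of "real (Suc i)"] y[OF i] i by simp
  qed (simp add: dilation_matrix_def)
  then have "det (replace_col ?D (vec t y) 0) = vec_index x 0 * det ?D"
    using cramer_lemma_mat[OF D x t(1)] by simp
  moreover have "vec_index x 0 = poly.coeff g (d - 1)" using t(1) by (simp add: x_def)
  ultimately show ?thesis using det_dilation_matrix_nonzero[OF t(2)] by simp
qed

text \<open>In the odd case \<open>d >= 3\<close> guarantees a first column. For
  \<open>d = 1\<close> the matrices are empty and the quotient of determinants is 1, while a lattice
  segment has lattice surface 2.\<close>

theorem theorem2p1:
  fixes P :: "(real ^ 'n) set"
    and d :: nat
  assumes d: "d = CARD('n)"
    and lattice: "lattice_polytope P"
    and full_dim: "aff_dim P = int d"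
  shows "(odd d \<and> d \<ge> 3 \<longrightarrow>
           (let t = (d - 1) div 2;
                D = dilation_matrix d t;
                A = replace_col D (vec t (\<lambda>i. real (boundary_count (dilate (Suc i) P)) - 2)) 0
            in lattice_surface P = det A / det D))
       \<and> (even d \<longrightarrow>
           (let t = d div 2;
                D = dilation_matrix d t;
                B = replace_col D (vec t (\<lambda>i. real (boundary_count (dilate (Suc i) P)))) 0
            in lattice_surface P = det B / det D))"
proof -
  obtain g :: "real poly" where g: "Polynomial.degree g \<le> d - 1"
    "\<And>i. even (d + i) \<Longrightarrow> poly.coeff g i = 0"
    "poly.coeff g 0 = (if odd d then 2 else 0)"
    "poly.coeff g (d - 1) = lattice_surface P"
    "\<And>k. k \<ge> 1 \<Longrightarrow> real (boundary_count (dilate k P)) = poly g (real k)"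
    using boundary_count_polynomial[OF lattice] full_dim unfolding d by blast
  have d0: "0 < d" by (simp add: d)
  have odd: "lattice_surface P = det (replace_col (dilation_matrix d t)
      (vec t (\<lambda>i. real (boundary_count (dilate (Suc i) P)) - 2)) 0) / det (dilation_matrix d t)"
    if "odd d" "d \<ge> 3" "t = (d - 1) div 2" for t
    unfolding g(4)[symmetric]
    by (rule cramer_leading_coeff[OF _ _ _ g(1,2)]) (use that g(3) g(5)[of "Suc _"] in auto)
  have even: "lattice_surface P = det (replace_col (dilation_matrix d t)
      (vec t (\<lambda>i. real (boundary_count (dilate (Suc i) P)))) 0) / det (dilation_matrix d t)"
    if "even d" "t = d div 2" for t
    unfolding g(4)[symmetric]
    by (rule cramer_leading_coeff[OF _ _ _ g(1,2)]) (use that d0 g(3) g(5)[of "Suc _"] in auto)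
  show ?thesis unfolding Let_def using odd even by simp
qed

end
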